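(* Consider the equation $$\dot{x}(t)+a(t)x(t)+b(t)x(h(t))=0,\quad t\geq 0,$$ where $a,b:[0,\infty)\to[0,\infty)$ are Lebesgue measurable, essentially bounded and nonnegative, and $h:[0,\infty)\to\mathbb{R}$ is Lebesgue measurable with $h(t)\leq t$ and $\lim_{t\to\infty}h(t)=\infty$. Suppose there is a constant $a_0$ with $a(t)\geq a_0>0$, that $b(t)\geq 0$, that $$h_0:=\limsup_{t\to\infty}\int_{h(t)}^t a(s)\,ds<\infty,$$ and that the inequality $$\frac{1}{\beta}e^{-h_0}>\ln\frac{\beta^2+\beta}{\beta^2+1}$$ holds, where $$\beta:=\limsup_{t\to\infty}\frac{b(t)}{a(t)}.$$ Then the equation is exponentially stable.
   Context: The initial condition is $x(t)=\varphi(t)$ for $t\leq 0$, where $\varphi:(-\infty,0]\to\mathbb{R}$ is a Borel measurable bounded function. A solution is a function $x$ that is absolutely continuous on $[0,\infty)$ (i.e. on its bounded subintervals), satisfies the equation for almost every $t\geq 0$, and satisfies the initial condition for $t\leq 0$. The equation is exponentially stable if there exist $M>0$ and $\alpha>0$ such that for every initial function $\varphi$ the corresponding solution satisfies $|x(t)|\leq M\|\varphi\|e^{-\alpha t}$ for all $t\geq 0$, where $\|\cdot\|$ is the sup-norm. *)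

theory Defs
  imports "HOL-Analysis.Analysis"
begin

text \<open>
  The library only has absolute continuity of measures; this is the usual
  \<open>\<epsilon>\<close>-\<open>\<delta>\<close> notion for a real function on a compact interval \<open>[c, d]\<close>.
\<close>

definition absolutely_continuous_on_interval :: "(real \<Rightarrow> real) \<Rightarrow> real \<Rightarrow> real \<Rightarrow> bool" where
  "absolutely_continuous_on_interval f c d \<longleftrightarrow>
     (\<forall>\<epsilon>>0. \<exists>\<delta>>0. \<forall>(n::nat) (u::nat \<Rightarrow> real) (v::nat \<Rightarrow> real).
        (\<forall>i<n. c \<le> u i \<and> u i \<le> v i \<and> v i \<le> d) \<longrightarrow>
        disjoint_family_on (\<lambda>i. {u i<..<v i}) {..<n} \<longrightarrow>
        (\<Sum>i<n. v i - u i) < \<delta> \<longrightarrow>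
        (\<Sum>i<n. \<bar>f (v i) - f (u i)\<bar>) < \<epsilon>)"

text \<open>
  Functions on \<open>[0, \<infinity>)\<close> or \<open>(-\<infinity>, 0]\<close> are represented by total functions on the reals
  whose values outside the intended domain are unconstrained and immaterial.
\<close>

definition initial_function :: "(real \<Rightarrow> real) \<Rightarrow> bool" where
  "initial_function \<phi> \<longleftrightarrow>
     \<phi> \<in> borel_measurable (restrict_space borel {..0}) \<and> bounded (\<phi> ` {..0})"

definition initial_norm :: "(real \<Rightarrow> real) \<Rightarrow> real" where
  "initial_norm \<phi> = (SUP t\<in>{..0}. \<bar>\<phi> t\<bar>)"

definition delay_solution ::
    "(real \<Rightarrow> real) \<Rightarrow> (real \<Rightarrow> real) \<Rightarrow> (real \<Rightarrow> real) \<Rightarrow> (real \<Rightarrow> real) \<Rightarrow> (real \<Rightarrow> real) \<Rightarrow> bool" where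
  "delay_solution a b h \<phi> x \<longleftrightarrow>
     (\<forall>c d. 0 \<le> c \<longrightarrow> c \<le> d \<longrightarrow> absolutely_continuous_on_interval x c d) \<and>
     (AE t in lebesgue_on {0..}. \<exists>x'. (x has_real_derivative x') (at t) \<and>
        x' + a t * x t + b t * x (h t) = 0) \<and>
     (\<forall>t\<le>0. x t = \<phi> t)"

text \<open>
  Since the equation is linear, the bound below forces the solution belonging to a given
  initial function to be unique.
\<close>

definition exponentially_stable ::
    "(real \<Rightarrow> real) \<Rightarrow> (real \<Rightarrow> real) \<Rightarrow> (real \<Rightarrow> real) \<Rightarrow> bool" where
  "exponentially_stable a b h \<longleftrightarrow>
     (\<exists>M>0. \<exists>\<alpha>>0. \<forall>\<phi>. initial_function \<phi> \<longrightarrow>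
        (\<forall>x. delay_solution a b h \<phi> x \<longrightarrow>
           (\<forall>t\<ge>0. \<bar>x t\<bar> \<le> M * initial_norm \<phi> * exp (- \<alpha> * t))))"

definition essentially_bounded :: "(real \<Rightarrow> real) \<Rightarrow> bool" where
  "essentially_bounded f \<longleftrightarrow> (\<exists>C. AE t in lebesgue_on {0..}. \<bar>f t\<bar> \<le> C)"

end

theory Submission
  imports Defs
begin

text \<open>
  Measure time by \<open>A t = \<integral>\<^sub>0\<^sup>t a\<close>, so that the equation becomes \<open>x' = - x - c x(h)\<close> with
  \<open>0 \<le> c \<le> \<beta>\<close> and delay at most \<open>r\<close>. If \<open>\<bar>x\<bar>\<close> attains its maximum \<open>K\<close> over the past at time \<open>T\<close>,
  say with \<open>x T = K\<close>, then \<open>x\<close> has a last zero \<open>\<tau> \<ge> T - r\<close>, since \<open>x\<close> decreases once it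
  has been positive for time \<open>r\<close>. Integrating backwards from \<open>\<tau>\<close> gives
  \<open>- x (h s) \<le> K min 1 (\<beta> (exp (r - (s - \<tau>)) - 1))\<close> for \<open>s \<ge> \<tau>\<close>, and integrating
  this forwards from \<open>\<tau>\<close> gives \<open>x T \<le> \<theta> K\<close>, where \<open>\<theta> < 1\<close> is equivalent to the assumed inequality. Hence
  solutions stay bounded by their history. The inequality is open, so it survives the small change
  of \<open>\<beta>\<close> and \<open>r\<close> caused by multiplying \<open>x\<close> by \<open>exp (\<alpha> * A t)\<close>, which yields exponential decay.
\<close>

section \<open>Indefinite integrals\<close>

lemma tagged_division_interval:
  fixes c d :: real
  assumes "p tagged_division_of {c..d}" "(x, K) \<in> p"
  obtains u v where "K = {u..v}" "u \<le> x" "x \<le> v" "c \<le> u" "v \<le> d" "measure lborel K = v - u"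
    "Sup K = v" "Inf K = u"
proof -
  obtain u v where K: "K = {u..v}"
    using tagged_division_ofD(4)[OF assms] by auto
  moreover have x: "x \<in> K" and sub: "K \<subseteq> {c..d}"
    using tagged_division_ofD(2,3)[OF assms] by auto
  ultimately have "u \<le> x" "x \<le> v" by auto
  then have "u \<le> v" by simp
  with K sub have "c \<le> u" "v \<le> d" by auto
  show thesis
    by (rule that[OF K \<open>u \<le> x\<close> \<open>x \<le> v\<close> \<open>c \<le> u\<close> \<open>v \<le> d\<close>]) (use K \<open>u \<le> v\<close> in auto)
qed

lemma sum_length_tagged_division_subset:
  fixes c d :: real
  assumes "c \<le> d" "p tagged_division_of {c..d}" "q \<subseteq> p"
  shows "(\<Sum>(x, K)\<in>q. Sup K - Inf K) \<le> d - c"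
proof -
  have "(\<Sum>(x, K)\<in>q. Sup K - Inf K) \<le> (\<Sum>(x, K)\<in>p. Sup K - Inf K)"
  proof (rule sum_mono2[OF tagged_division_ofD(1)[OF assms(2)] assms(3)], clarify)
    fix x K assume "(x, K) \<in> p"
    then obtain u v where "Sup K = v" "Inf K = u" "u \<le> x" "x \<le> v"
      by (rule tagged_division_interval[OF assms(2)])
    then show "0 \<le> Sup K - Inf K" by simp
  qed
  also have "\<dots> = d - c"
    using additive_tagged_division_1[OF assms(1,2), of "\<lambda>x. x"] by simp
  finally show ?thesis .
qed

text \<open>Increments of \<open>f\<close> telescope over a tagged division, so a Riemann sum of
  \<open>g\<close> misses \<open>f d - f c\<close> by at most the sum of the local errors. Both
  theorems on indefinite integrals below verify this criterion.\<close>

lemma has_integral_increment: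
  fixes f g :: "real \<Rightarrow> real"
  assumes "c \<le> d"
    and "\<And>e. e > 0 \<Longrightarrow> \<exists>\<gamma>. gauge \<gamma> \<and> (\<forall>p. p tagged_division_of {c..d} \<and> \<gamma> fine p \<longrightarrow>
           (\<Sum>(x, K)\<in>p. \<bar>(f (Sup K) - f (Inf K)) - measure lborel K * g x\<bar>) < e)"
  shows "(g has_integral f d - f c) {c..d}"
  unfolding has_integral_real
proof (intro allI impI)
  fix e :: real assume "e > 0"
  from assms(2)[OF this] obtain \<gamma> where \<gamma>: "gauge \<gamma>"
    "\<forall>p. p tagged_division_of {c..d} \<and> \<gamma> fine p \<longrightarrow>
       (\<Sum>(x, K)\<in>p. \<bar>(f (Sup K) - f (Inf K)) - measure lborel K * g x\<bar>) < e"
    by (elim exE conjE) (rule that)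
  have small: "norm ((\<Sum>(x, k)\<in>p. measure lborel k *\<^sub>R g x) - (f d - f c)) < e"
    if p: "p tagged_division_of {c..d}" "\<gamma> fine p" for p
  proof -
    have "(\<Sum>(x, k)\<in>p. measure lborel k *\<^sub>R g x) - (f d - f c) =
        (\<Sum>(x, k)\<in>p. measure lborel k *\<^sub>R g x) - (\<Sum>(x, K)\<in>p. f (Sup K) - f (Inf K))"
      using additive_tagged_division_1[OF \<open>c \<le> d\<close> p(1), of f] by simp
    also have "\<dots> = - (\<Sum>(x, K)\<in>p. (f (Sup K) - f (Inf K)) - measure lborel K * g x)"
      by (simp add: sum_subtractf case_prod_unfold)
    also have "norm \<dots> \<le> (\<Sum>(x, K)\<in>p. \<bar>(f (Sup K) - f (Inf K)) - measure lborel K * g x\<bar>)"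
      unfolding case_prod_unfold real_norm_def abs_minus_cancel by (rule sum_abs)
    also have "\<dots> < e" using \<gamma>(2)[rule_format, OF conjI, OF p] .
    finally show ?thesis .
  qed
  show "\<exists>\<gamma>. gauge \<gamma> \<and> (\<forall>\<D>. \<D> tagged_division_of {c..d} \<and> \<gamma> fine \<D> \<longrightarrow>
       norm ((\<Sum>(x, k)\<in>\<D>. measure lborel k *\<^sub>R g x) - (f d - f c)) < e)"
    by (intro exI[of _ \<gamma>] conjI allI impI \<gamma>(1), elim conjE) (rule small)
qed

text \<open>
  A point where \<open>f\<close> is differentiable gets a ball on which the difference quotient is good;
  the other points get a neighbourhood inside an open set of small measure, where absolute
  continuity controls the increments of \<open>f\<close>.
\<close>
theorem absolutely_continuous_has_integral:
  fixes f g :: "real \<Rightarrow> real"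
  assumes ac: "absolutely_continuous_on_interval f c d" and "c \<le> d" and N: "negligible N"
    and der: "\<And>t. t \<in> {c..d} - N \<Longrightarrow> (f has_real_derivative g t) (at t)"
  shows "(g has_integral f d - f c) {c..d}"
proof (rule has_integral_spike[OF N])
  \<comment> \<open>With the value 0 on \<open>N\<close>, a tag in \<open>N\<close> contributes only
    the increment of \<open>f\<close>, which absolute continuity controls.\<close>
  define g' where "g' x = (if x \<in> N then 0 else g x)" for x
  show "g x = g' x" if "x \<in> {c..d} - N" for x
    using that by (simp add: g'_def)
  show "(g' has_integral f d - f c) {c..d}"
  proof (rule has_integral_increment[OF \<open>c \<le> d\<close>])
    fix e :: real assume "e > 0"
    then obtain \<delta> where "\<delta> > 0" and \<delta>: "\<And>(n::nat) u v.
        (\<forall>i<n. c \<le> u i \<and> u i \<le> v i \<and> v i \<le> d) \<Longrightarrow>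
        disjoint_family_on (\<lambda>i. {u i<..<v i}) {..<n} \<Longrightarrow>
        (\<Sum>i<n. v i - u i) < \<delta> \<Longrightarrow> (\<Sum>i<n. \<bar>f (v i) - f (u i)\<bar>) < e / 2"
      using ac[unfolded absolutely_continuous_on_interval_def, rule_format, of "e / 2"] by auto
    have "N \<in> sets lebesgue" using N by (rule negligible_imp_sets)
    then obtain U where "open U" "N \<subseteq> U" and UN: "U - N \<in> lmeasurable"
        "emeasure lebesgue (U - N) < ennreal \<delta>"
      using \<open>\<delta> > 0\<close> by (rule sets_lebesgue_outer_open)
    have U: "U \<in> lmeasurable" and mU: "measure lebesgue U < \<delta>"
    proof -
      have *: "U = (U - N) \<union> N" using \<open>N \<subseteq> U\<close> by auto
      show "U \<in> lmeasurable"
        by (subst *) (intro fmeasurable.Un UN negligible_imp_measurable N)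
      have "measure lebesgue U \<le> measure lebesgue (U - N) + measure lebesgue N"
        using measure_Un_le[of "U - N" lebesgue N] * UN(1) \<open>N \<in> sets lebesgue\<close>
        by (auto simp: fmeasurable_def)
      also have "measure lebesgue N = 0" using N by (rule negligible_imp_measure0)
      also have "measure lebesgue (U - N) < \<delta>"
        using UN \<open>\<delta> > 0\<close> by (simp add: emeasure_eq_measure2 ennreal_less_iff)
      finally show "measure lebesgue U < \<delta>" by simp
    qed
    \<comment> \<open>Intervals tagged outside \<open>N\<close> have total length at most
      \<open>d - c\<close>, so they contribute at most \<open>e / 2\<close>; the \<open>+ 1\<close>
      keeps the denominator positive when \<open>c = d\<close>.\<close>
    define \<epsilon> where "\<epsilon> = e / (2 * (d - c + 1))"
    have "\<epsilon> > 0" using \<open>e > 0\<close> \<open>c \<le> d\<close> by (simp add: \<epsilon>_def)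
    have "\<exists>r>0. \<forall>y. \<bar>y - x\<bar> < r \<longrightarrow> \<bar>f y - f x - g x * (y - x)\<bar> \<le> \<epsilon> * \<bar>y - x\<bar>"
      if "x \<in> {c..d} - N" for x
      using der[OF that] \<open>\<epsilon> > 0\<close>
      unfolding has_field_derivative_def has_derivative_at_alt by auto
    then obtain r where r: "\<And>x. x \<in> {c..d} - N \<Longrightarrow> r x > 0"
      "\<And>x y. x \<in> {c..d} - N \<Longrightarrow> \<bar>y - x\<bar> < r x \<Longrightarrow> \<bar>f y - f x - g x * (y - x)\<bar> \<le> \<epsilon> * \<bar>y - x\<bar>"
      by metis
    define \<gamma> where "\<gamma> x = (if x \<in> N then U else if x \<in> {c..d} then ball x (r x) else UNIV)" for x
    have gauge: "gauge \<gamma>"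
      using \<open>open U\<close> \<open>N \<subseteq> U\<close> r(1) by (auto simp: gauge_def \<gamma>_def)
    have small: "(\<Sum>(x, K)\<in>p. \<bar>(f (Sup K) - f (Inf K)) - measure lborel K * g' x\<bar>) < e"
      if p: "p tagged_division_of {c..d}" "\<gamma> fine p" for p
    proof -
      let ?S = "\<lambda>q. \<Sum>(x, K)\<in>q. \<bar>(f (Sup K) - f (Inf K)) - measure lborel K * g' x\<bar>"
      define q where "q = {xK \<in> p. fst xK \<in> N}"
      have fin: "finite p" using p(1) by auto
      then have "finite q" by (simp add: q_def)
      have "?S (p - q) \<le> (\<Sum>(x, K)\<in>p - q. \<epsilon> * (Sup K - Inf K))"
      proof (rule sum_mono, clarify)
        fix x K assume xK: "(x, K) \<in> p" "(x, K) \<notin> q"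
        then have "x \<notin> N" by (simp add: q_def)
        from tagged_division_interval[OF p(1) xK(1)] obtain u v where uv:
          "K = {u..v}" "u \<le> x" "x \<le> v" "c \<le> u" "v \<le> d" "measure lborel K = v - u" "Sup K = v" "Inf K = u" .
        then have x: "x \<in> {c..d} - N" using \<open>x \<notin> N\<close> by auto
        then have "K \<subseteq> ball x (r x)"
          using fineD[OF p(2) xK(1)] by (auto simp: \<gamma>_def)
        then have "\<bar>v - x\<bar> < r x" "\<bar>u - x\<bar> < r x"
          using uv subsetD[of K "ball x (r x)" v] subsetD[of K "ball x (r x)" u]
          by (auto simp: dist_real_def)
        then have "\<bar>f v - f x - g x * (v - x)\<bar> \<le> \<epsilon> * (v - x)"
            "\<bar>f u - f x - g x * (u - x)\<bar> \<le> \<epsilon> * (x - u)"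
          using r(2)[OF x, of v] r(2)[OF x, of u] uv(2,3) by auto
        \<comment> \<open>The tag lies between the endpoints, so the two error bounds add up to
          \<open>\<epsilon>\<close> times the length.\<close>
        then have "\<bar>f v - f u - (v - u) * g x\<bar> \<le> \<epsilon> * (v - u)"
          by (simp add: algebra_simps abs_le_iff)
        then show "\<bar>(f (Sup K) - f (Inf K)) - measure lborel K * g' x\<bar> \<le> \<epsilon> * (Sup K - Inf K)"
          using uv \<open>x \<notin> N\<close> by (simp add: g'_def)
      qed
      also have "\<dots> = \<epsilon> * (\<Sum>(x, K)\<in>p - q. Sup K - Inf K)"
        by (simp add: sum_distrib_left case_prod_unfold)
      also have "\<dots> \<le> \<epsilon> * (d - c)"
        using \<open>\<epsilon> > 0\<close> by (intro mult_left_mono sum_length_tagged_division_subset[OF \<open>c \<le> d\<close> p(1)]) auto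
      also have "\<dots> \<le> e / 2"
        using \<open>e > 0\<close> \<open>c \<le> d\<close> by (simp add: \<epsilon>_def field_simps)
      finally have S1: "?S (p - q) \<le> e / 2" .
      \<comment> \<open>Absolute continuity speaks of indexed families, hence an enumeration of the
        intervals tagged in \<open>N\<close>. They have disjoint interiors and lie in
        \<open>U\<close>, so their total length is below \<open>\<delta>\<close>.\<close>
      obtain k where k: "bij_betw k {..<card q} q"
        using ex_bij_betw_nat_finite[OF \<open>finite q\<close>] by (auto simp: atLeast0LessThan)
      define u where "u i = Inf (snd (k i))" for i
      define v where "v i = Sup (snd (k i))" for i
      have kq: "k i \<in> q" if "i < card q" for i
        using k that by (auto simp: bij_betw_def)
      have uv: "snd (k i) = {u i..v i} \<and> u i \<le> v i \<and> c \<le> u i \<and> v i \<le> d \<and> {u i..v i} \<subseteq> U"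
        if i: "i < card q" for i
      proof -
        obtain x K where xK: "k i = (x, K)" by fastforce
        then have xp: "(x, K) \<in> p" "x \<in> N" using kq[OF i] by (auto simp: q_def)
        from tagged_division_interval[OF p(1) xp(1)] obtain u' v' where uv:
          "K = {u'..v'}" "u' \<le> x" "x \<le> v'" "c \<le> u'" "v' \<le> d" "measure lborel K = v' - u'"
          "Sup K = v'" "Inf K = u'" .
        have "K \<subseteq> U" using fineD[OF p(2) xp(1)] xp(2) by (simp add: \<gamma>_def)
        with uv show ?thesis by (simp add: u_def v_def xK)
      qed
      have disj: "disjoint_family_on (\<lambda>i. {u i<..<v i}) {..<card q}"
        unfolding disjoint_family_on_def
      proof (intro ballI impI)
        fix i j assume ij: "i \<in> {..<card q}" "j \<in> {..<card q}" "i \<noteq> j"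
        then have "k i \<noteq> k j" using k by (auto simp: bij_betw_def inj_on_def)
        moreover have "k i \<in> p" "k j \<in> p" using kq ij by (auto simp: q_def)
        ultimately have "interior (snd (k i)) \<inter> interior (snd (k j)) = {}"
          using tagged_division_ofD(5)[OF p(1), of "fst (k i)" "snd (k i)" "fst (k j)" "snd (k j)"]
          by (auto simp: prod_eq_iff)
        then show "{u i<..<v i} \<inter> {u j<..<v j} = {}"
          using uv ij by simp
      qed
      have "(\<Sum>i<card q. v i - u i) = (\<Sum>i<card q. measure lebesgue {u i<..<v i})"
        using uv by (intro sum.cong) auto
      also have "\<dots> = measure lebesgue (\<Union>i<card q. {u i<..<v i})"
        using disj fmeasurableD2[OF lmeasurable_box, of "u i" "v i" for i]
        by (subst measure_finite_Union) auto
      also have "\<dots> \<le> measure lebesgue U"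
      proof (rule measure_mono_fmeasurable[OF _ _ U])
        show "(\<Union>i<card q. {u i<..<v i}) \<subseteq> U"
          using uv by fastforce
      qed (auto intro!: sets.finite_UN)
      also have "\<dots> < \<delta>" by (rule mU)
      finally have "(\<Sum>i<card q. \<bar>f (v i) - f (u i)\<bar>) < e / 2"
        using uv disj by (intro \<delta>) auto
      also have "(\<Sum>i<card q. \<bar>f (v i) - f (u i)\<bar>) = (\<Sum>xK\<in>q. \<bar>f (Sup (snd xK)) - f (Inf (snd xK))\<bar>)"
        unfolding u_def v_def by (rule sum.reindex_bij_betw[OF k])
      also have "\<dots> = ?S q"
        by (intro sum.cong) (auto simp: q_def g'_def)
      finally have S2: "?S q < e / 2" .
      have "?S p = ?S (p - q) + ?S q"
        using fin by (intro sum.subset_diff) (auto simp: q_def)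
      with S1 S2 show ?thesis by linarith
    qed
    show "\<exists>\<gamma>. gauge \<gamma> \<and> (\<forall>p. p tagged_division_of {c..d} \<and> \<gamma> fine p \<longrightarrow>
           (\<Sum>(x, K)\<in>p. \<bar>(f (Sup K) - f (Inf K)) - measure lborel K * g' x\<bar>) < e)"
      by (intro exI[of _ \<gamma>] conjI allI impI gauge, elim conjE) (rule small)
  qed
qed

text \<open>
  Stated for indefinite integrals rather than derivatives, so that Lebesgue's differentiation
  theorem is not needed: Henstock's lemma supplies the local comparison of \<open>f\<close> with \<open>g\<close>.
\<close>
theorem has_integral_chain_rule:
  fixes f g :: "real \<Rightarrow> 'a::euclidean_space" and \<Phi> :: "'a \<Rightarrow> real"
  assumes "c \<le> d" and lip: "L-lipschitz_on {c..d} f"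
    and int: "\<And>u v. c \<le> u \<Longrightarrow> u \<le> v \<Longrightarrow> v \<le> d \<Longrightarrow> (g has_integral f v - f u) {u..v}"
    and der: "\<And>s. s \<in> {c..d} \<Longrightarrow> (\<Phi> has_derivative \<Phi>' s) (at (f s))"
    and bnd: "\<And>s w. s \<in> {c..d} \<Longrightarrow> \<bar>\<Phi>' s w\<bar> \<le> C * norm w"
  shows "((\<lambda>s. \<Phi>' s (g s)) has_integral \<Phi> (f d) - \<Phi> (f c)) {c..d}"
proof (rule has_integral_increment[OF \<open>c \<le> d\<close>, of "\<lambda>s. \<Phi> (f s)"])
  fix e :: real assume "e > 0"
  have "L \<ge> 0" using lip by (rule lipschitz_on_nonneg)
  \<comment> \<open>The linearisation errors sum to at most \<open>\<epsilon> * L * (d - c)\<close>,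
    the Henstock errors, magnified by \<open>\<bar>C\<bar>\<close>, to less than the other half of
    \<open>e\<close>.\<close>
  define \<epsilon> where "\<epsilon> = e / (2 * (L * (d - c) + 1))"
  have pos: "L * (d - c) + 1 > 0"
    using \<open>L \<ge> 0\<close> \<open>c \<le> d\<close> by (simp add: add_nonneg_pos)
  then have "\<epsilon> > 0" using \<open>e > 0\<close> by (simp add: \<epsilon>_def)
  have "g integrable_on cbox c d"
    using int[of c d] \<open>c \<le> d\<close> by (auto simp: integrable_on_def)
  moreover have "e / (2 * (\<bar>C\<bar> + 1)) > 0" using \<open>e > 0\<close> by (simp add: add_nonneg_pos)
  ultimately obtain \<gamma>\<^sub>1 where "gauge \<gamma>\<^sub>1" and \<gamma>\<^sub>1:
    "\<And>p. \<lbrakk>p tagged_partial_division_of cbox c d; \<gamma>\<^sub>1 fine p\<rbrakk> \<Longrightarrow>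
      (\<Sum>(x,K)\<in>p. norm (measure lborel K *\<^sub>R g x - integral K g)) < e / (2 * (\<bar>C\<bar> + 1))"
    by (rule Henstock_lemma) (rule that)
  have "\<exists>r>0. \<forall>y. norm (y - f s) < r \<longrightarrow> \<bar>\<Phi> y - \<Phi> (f s) - \<Phi>' s (y - f s)\<bar> \<le> \<epsilon> * norm (y - f s)"
    if "s \<in> {c..d}" for s
    using der[OF that] \<open>\<epsilon> > 0\<close> unfolding has_derivative_at_alt by auto
  then obtain r where r: "\<And>s. s \<in> {c..d} \<Longrightarrow> r s > 0"
    "\<And>s y. s \<in> {c..d} \<Longrightarrow> norm (y - f s) < r s \<Longrightarrow>
       \<bar>\<Phi> y - \<Phi> (f s) - \<Phi>' s (y - f s)\<bar> \<le> \<epsilon> * norm (y - f s)"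
    by metis
  \<comment> \<open>The Lipschitz bound sends this ball into the ball of radius \<open>r s\<close>
    about \<open>f s\<close>; dividing by \<open>L + 1\<close> also covers
    \<open>L = 0\<close>.\<close>
  define \<gamma>\<^sub>2 where "\<gamma>\<^sub>2 s = (if s \<in> {c..d} then ball s (r s / (L + 1)) else UNIV)" for s
  have "gauge \<gamma>\<^sub>2"
    using r(1) \<open>L \<ge> 0\<close> by (auto simp: gauge_def \<gamma>\<^sub>2_def add_nonneg_pos)
  with \<open>gauge \<gamma>\<^sub>1\<close> have gauge: "gauge (\<lambda>x. \<gamma>\<^sub>1 x \<inter> \<gamma>\<^sub>2 x)" by (rule gauge_Int)
  have small: "(\<Sum>(x, K)\<in>p. \<bar>(\<Phi> (f (Sup K)) - \<Phi> (f (Inf K))) - measure lborel K * \<Phi>' x (g x)\<bar>) < e"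
    if p: "p tagged_division_of {c..d}" "(\<lambda>x. \<gamma>\<^sub>1 x \<inter> \<gamma>\<^sub>2 x) fine p" for p
  proof -
    have fine: "\<gamma>\<^sub>1 fine p" "\<gamma>\<^sub>2 fine p" using p(2) by (auto simp: fine_Int)
    let ?H = "\<lambda>x K. norm (measure lborel K *\<^sub>R g x - integral K g)"
    have "(\<Sum>(x, K)\<in>p. \<bar>(\<Phi> (f (Sup K)) - \<Phi> (f (Inf K))) - measure lborel K * \<Phi>' x (g x)\<bar>)
       \<le> (\<Sum>(x, K)\<in>p. \<epsilon> * L * (Sup K - Inf K) + \<bar>C\<bar> * ?H x K)"
    proof (rule sum_mono, clarify)
      fix x K assume xK: "(x, K) \<in> p"
      from tagged_division_interval[OF p(1) xK] obtain u v where uv: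
        "K = {u..v}" "u \<le> x" "x \<le> v" "c \<le> u" "v \<le> d" "measure lborel K = v - u"
        "Sup K = v" "Inf K = u" .
      then have x: "x \<in> {c..d}" by auto
      interpret bounded_linear "\<Phi>' x" by (rule has_derivative_bounded_linear[OF der[OF x]])
      have "K \<subseteq> ball x (r x / (L + 1))"
        using fineD[OF fine(2) xK] x by (auto simp: \<gamma>\<^sub>2_def)
      then have near: "\<bar>w - x\<bar> < r x / (L + 1)" if "w \<in> {u..v}" for w
        using subsetD[of K "ball x (r x / (L + 1))" w] that uv(1) by (auto simp: dist_real_def)
      have est: "\<bar>\<Phi> (f w) - \<Phi> (f x) - \<Phi>' x (f w - f x)\<bar> \<le> \<epsilon> * L * \<bar>w - x\<bar>"
        if w: "w \<in> {u..v}" for w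
      proof -
        have "norm (f w - f x) \<le> L * \<bar>w - x\<bar>"
          using lipschitz_onD[OF lip, of w x] x w uv by (auto simp: dist_norm)
        moreover have "L * \<bar>w - x\<bar> \<le> (L + 1) * \<bar>w - x\<bar>" by (simp add: algebra_simps)
        moreover have "\<dots> < r x"
          using near[OF w] \<open>L \<ge> 0\<close> by (simp add: pos_less_divide_eq mult.commute)
        ultimately have "norm (f w - f x) < r x" by linarith
        from r(2)[OF x this] have "\<bar>\<Phi> (f w) - \<Phi> (f x) - \<Phi>' x (f w - f x)\<bar> \<le> \<epsilon> * norm (f w - f x)" .
        also have "\<dots> \<le> \<epsilon> * (L * \<bar>w - x\<bar>)"
          using \<open>norm (f w - f x) \<le> L * \<bar>w - x\<bar>\<close> \<open>\<epsilon> > 0\<close> by simp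
        finally show ?thesis by (simp add: mult.assoc)
      qed
      have H: "integral K g = f v - f u"
        unfolding uv(1) using int[of u v] uv by (intro integral_unique) auto
      \<comment> \<open>The error on \<open>K\<close> is split into the linearisation errors of
        \<open>\<Phi>\<close> at both endpoints and \<open>\<Phi>' x\<close> applied to the Henstock
        defect.\<close>
      have "\<Phi>' x ((v - u) *\<^sub>R g x - (f v - f u)) = (v - u) * \<Phi>' x (g x) - (\<Phi>' x (f v - f x) - \<Phi>' x (f u - f x))"
        by (simp add: diff scaleR)
      moreover have "\<bar>\<Phi>' x ((v - u) *\<^sub>R g x - (f v - f u))\<bar> \<le> \<bar>C\<bar> * ?H x K"
      proof -
        have "\<bar>\<Phi>' x ((v - u) *\<^sub>R g x - (f v - f u))\<bar> \<le> C * norm ((v - u) *\<^sub>R g x - (f v - f u))"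
          by (rule bnd[OF x])
        also have "\<dots> \<le> \<bar>C\<bar> * norm ((v - u) *\<^sub>R g x - (f v - f u))"
          by (intro mult_right_mono) auto
        finally show ?thesis by (simp add: H uv(6))
      qed
      moreover have "\<bar>\<Phi> (f v) - \<Phi> (f x) - \<Phi>' x (f v - f x)\<bar> \<le> \<epsilon> * L * (v - x)"
        "\<bar>\<Phi> (f u) - \<Phi> (f x) - \<Phi>' x (f u - f x)\<bar> \<le> \<epsilon> * L * (x - u)"
        using est[of v] est[of u] uv(2,3) by auto
      moreover have "\<epsilon> * L * (v - u) = \<epsilon> * L * (v - x) + \<epsilon> * L * (x - u)"
        by (simp add: algebra_simps)
      ultimately have "\<bar>(\<Phi> (f v) - \<Phi> (f u)) - (v - u) * \<Phi>' x (g x)\<bar> \<le> \<epsilon> * L * (v - u) + \<bar>C\<bar> * ?H x K"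
        by linarith
      then show "\<bar>(\<Phi> (f (Sup K)) - \<Phi> (f (Inf K))) - measure lborel K * \<Phi>' x (g x)\<bar>
          \<le> \<epsilon> * L * (Sup K - Inf K) + \<bar>C\<bar> * ?H x K"
        unfolding uv(6-8) .
    qed
    also have "\<dots> = \<epsilon> * L * (\<Sum>(x, K)\<in>p. Sup K - Inf K) + \<bar>C\<bar> * (\<Sum>(x, K)\<in>p. ?H x K)"
      by (simp only: case_prod_unfold sum.distrib sum_distrib_left)
    also have "\<dots> \<le> \<epsilon> * L * (d - c) + (\<bar>C\<bar> + 1) * (\<Sum>(x, K)\<in>p. ?H x K)"
      using \<open>\<epsilon> > 0\<close> \<open>L \<ge> 0\<close>
      by (intro add_mono mult_left_mono mult_right_mono sum_length_tagged_division_subset[OF \<open>c \<le> d\<close> p(1)] sum_nonneg)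
         auto
    also have "\<dots> < e / 2 + (\<bar>C\<bar> + 1) * (e / (2 * (\<bar>C\<bar> + 1)))"
    proof (rule add_le_less_mono)
      have "\<epsilon> * (L * (d - c)) \<le> \<epsilon> * (L * (d - c) + 1)" using \<open>\<epsilon> > 0\<close> by simp
      also have "\<dots> = e / 2"
      proof -
        have "e / (2 * k) * k = e / 2" if "k > 0" for k :: real
          using that by simp
        from this[OF pos] show ?thesis unfolding \<epsilon>_def .
      qed
      finally show "\<epsilon> * L * (d - c) \<le> e / 2" by (simp add: mult.assoc)
      show "(\<bar>C\<bar> + 1) * (\<Sum>(x, K)\<in>p. ?H x K) < (\<bar>C\<bar> + 1) * (e / (2 * (\<bar>C\<bar> + 1)))"
        using \<gamma>\<^sub>1[of p] p(1) fine(1)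
        by (intro mult_strict_left_mono) (auto simp: tagged_division_of_def add_nonneg_pos)
    qed
    also have "\<dots> = e" by (simp add: field_simps)
    finally show ?thesis .
  qed
  show "\<exists>\<gamma>. gauge \<gamma> \<and> (\<forall>p. p tagged_division_of {c..d} \<and> \<gamma> fine p \<longrightarrow>
      (\<Sum>(x, K)\<in>p. \<bar>(\<Phi> (f (Sup K)) - \<Phi> (f (Inf K))) - measure lborel K * \<Phi>' x (g x)\<bar>) < e)"
    by (intro exI[of _ "\<lambda>x. \<gamma>\<^sub>1 x \<inter> \<gamma>\<^sub>2 x"] conjI allI impI gauge, elim conjE) (rule small)
qed

section \<open>Boundedness by the history\<close>

text \<open>The constant \<open>\<theta>\<close> of the overview in closed form: the extremal growth
  at elapsed time \<open>D = \<sigma> + exp (- r) / \<beta>\<close>, where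
  \<open>\<sigma> = r - ln (1 + 1 / \<beta>)\<close>.\<close>

definition contraction_factor :: "real \<Rightarrow> real \<Rightarrow> real" where
  "contraction_factor \<beta> r = \<beta>\<^sup>2 * ((1 + 1 / \<beta>) * exp (- exp (- r) / \<beta>) - 1)"

text \<open>Exponentiating the assumption and clearing denominators gives \<open>(\<beta>\<^sup>2 +
  \<beta>) * exp (- exp (- r) / \<beta>) < \<beta>\<^sup>2 + 1\<close>, whose left-hand side is
  \<open>contraction_factor \<beta> r + \<beta>\<^sup>2\<close>.\<close>

lemma contraction_factor_less_1:
  assumes "\<beta> > 0" and "(1 / \<beta>) * exp (- r) > ln ((\<beta>\<^sup>2 + \<beta>) / (\<beta>\<^sup>2 + 1))"
  shows "contraction_factor \<beta> r < 1"
proof -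
  have pos: "\<beta>\<^sup>2 + \<beta> > 0" "\<beta>\<^sup>2 + 1 > 0"
    using assms(1) by (auto intro: add_pos_pos add_nonneg_pos)
  have "exp (ln ((\<beta>\<^sup>2 + \<beta>) / (\<beta>\<^sup>2 + 1))) < exp (exp (- r) / \<beta>)"
    using assms(2) by simp
  then have "(\<beta>\<^sup>2 + \<beta>) / (\<beta>\<^sup>2 + 1) < exp (exp (- r) / \<beta>)"
    using pos by simp
  then have "\<beta>\<^sup>2 + \<beta> < (\<beta>\<^sup>2 + 1) * exp (exp (- r) / \<beta>)"
    using pos by (simp add: field_simps)
  then have "(\<beta>\<^sup>2 + \<beta>) * exp (- exp (- r) / \<beta>) < \<beta>\<^sup>2 + 1"
    by (simp add: exp_minus field_simps)
  moreover have "\<beta>\<^sup>2 * (1 + 1 / \<beta>) = \<beta>\<^sup>2 + \<beta>"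
    using assms(1) by (simp add: field_simps power2_eq_square)
  ultimately show ?thesis
    unfolding contraction_factor_def by (simp add: right_diff_distrib flip: mult.assoc)
qed

text \<open>
  The left-hand side is the value after time \<open>D\<close> of the worst solution starting from \<open>0\<close> with
  history bounded by \<open>1\<close>; its maximum over \<open>D\<close> is the contraction factor.
\<close>
lemma extremal_growth_le:
  fixes \<beta> r D :: real
  assumes "\<beta> > 0"
  defines "\<sigma> \<equiv> r - ln (1 + 1 / \<beta>)"
  shows "\<beta> * (\<beta> * exp (r - D) * (D - \<sigma> + 1) - exp (- D) - \<beta>) \<le> contraction_factor \<beta> r"
proof -
  \<comment> \<open>Factoring leaves \<open>1 + z\<close> with
    \<open>z = D - \<sigma> - exp (- r) / \<beta>\<close>; the tangent inequality
    \<open>1 + z \<le> exp z\<close> removes \<open>D\<close> and is sharp at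
    \<open>z = 0\<close>.\<close>
  have "\<beta> * exp (r - D) * (D - \<sigma> + 1) - exp (- D) = \<beta> * exp (r - D) * (1 + (D - \<sigma> - exp (- r) / \<beta>))"
    using assms(1) by (simp add: field_simps flip: exp_add)
  also have "\<dots> \<le> \<beta> * exp (r - D) * exp (D - \<sigma> - exp (- r) / \<beta>)"
    using assms(1) by (intro mult_left_mono exp_ge_add_one_self) auto
  also have "\<dots> = \<beta> * exp (r - \<sigma> - exp (- r) / \<beta>)"
    by (simp add: mult.assoc flip: exp_add)
  also have "\<dots> = \<beta> * ((1 + 1 / \<beta>) * exp (- exp (- r) / \<beta>))"
  proof -
    have "exp (r - \<sigma> - exp (- r) / \<beta>) = exp (ln (1 + 1 / \<beta>)) * exp (- exp (- r) / \<beta>)"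
      by (simp add: \<sigma>_def flip: exp_add)
    then show ?thesis using assms(1) by (simp add: add_pos_pos)
  qed
  finally have "\<beta> * exp (r - D) * (D - \<sigma> + 1) - exp (- D) - \<beta> \<le> \<beta> * ((1 + 1 / \<beta>) * exp (- exp (- r) / \<beta>) - 1)"
    by (simp add: right_diff_distrib)
  then have "\<beta> * (\<beta> * exp (r - D) * (D - \<sigma> + 1) - exp (- D) - \<beta>)
      \<le> \<beta> * (\<beta> * ((1 + 1 / \<beta>) * exp (- exp (- r) / \<beta>) - 1))"
    using assms(1) by (intro mult_left_mono) auto
  then show ?thesis by (simp add: contraction_factor_def power2_eq_square mult.assoc)
qed

text \<open>Before elapsed time \<open>\<sigma> = r - ln (1 + 1 / \<beta>)\<close> the extremal
  solution grows under the constant history bound. The early value increases with \<open>D\<close>,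
  and at \<open>D = \<sigma>\<close> it equals the later formula because
  \<open>\<beta> * exp (r - \<sigma>) = \<beta> + 1\<close>.\<close>

lemma extremal_growth_le_early:
  assumes "\<beta> > 0" and "D \<le> r - ln (1 + 1 / \<beta>)"
  shows "\<beta> * (1 - exp (- D)) \<le> contraction_factor \<beta> r"
proof -
  define \<sigma> where "\<sigma> = r - ln (1 + 1 / \<beta>)"
  have "exp (r - \<sigma>) = 1 + 1 / \<beta>"
    using assms(1) by (simp add: \<sigma>_def add_pos_pos)
  then have *: "\<beta> * exp (r - \<sigma>) = \<beta> + 1"
    using assms(1) by (simp add: field_simps)
  have "\<beta> * (1 - exp (- D)) \<le> \<beta> * (1 - exp (- \<sigma>))"
    using assms by (intro mult_left_mono) (auto simp: \<sigma>_def)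
  also have "\<dots> = \<beta> * (\<beta> * exp (r - \<sigma>) * (\<sigma> - \<sigma> + 1) - exp (- \<sigma>) - \<beta>)"
    by (simp add: *)
  also have "\<dots> \<le> contraction_factor \<beta> r"
    using extremal_growth_le[OF assms(1), of r \<sigma>] by (simp add: \<sigma>_def)
  finally show ?thesis .
qed

text \<open>This is \<open>y' = - b y - c y(h)\<close> after multiplication by the integrating
  factor \<open>exp B\<close>, in integrated form, with \<open>B\<close> as clock and delay at most
  \<open>r\<close> on it. From \<open>t\<^sub>1\<close> on the coefficient and delay bounds hold;
  \<open>t\<^sub>2\<close> and \<open>t\<^sub>3\<close> each leave room for one more delay.
  \<open>r_ge\<close> makes the switching time \<open>r - ln (1 + 1 / \<beta>)\<close>
  nonnegative.\<close>

locale weighted_delay_equation =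
  fixes y B b c h :: "real \<Rightarrow> real" and \<beta> r t\<^sub>1 t\<^sub>2 t\<^sub>3 :: real
  assumes beta_pos: "\<beta> > 0" and r_ge: "ln (1 + 1 / \<beta>) \<le> r"
    and cont_B: "continuous_on {0..} B" and cont_y: "continuous_on {0..} y"
    and b_nonneg: "\<And>s. 0 \<le> s \<Longrightarrow> 0 \<le> b s"
    and int_B: "\<And>u v. 0 \<le> u \<Longrightarrow> u \<le> v \<Longrightarrow> (b has_integral B v - B u) {u..v}"
    and int_exp_B: "\<And>u v. 0 \<le> u \<Longrightarrow> u \<le> v \<Longrightarrow>
      ((\<lambda>s. b s * exp (B s)) has_integral exp (B v) - exp (B u)) {u..v}"
    and int_y: "\<And>u v. t\<^sub>1 \<le> u \<Longrightarrow> u \<le> v \<Longrightarrow>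
      ((\<lambda>s. - (c s * y (h s)) * exp (B s)) has_integral exp (B v) * y v - exp (B u) * y u) {u..v}"
    and c_nonneg: "\<And>s. t\<^sub>1 \<le> s \<Longrightarrow> 0 \<le> c s" and c_le: "\<And>s. t\<^sub>1 \<le> s \<Longrightarrow> c s \<le> \<beta> * b s"
    and h_le: "\<And>s. t\<^sub>1 \<le> s \<Longrightarrow> h s \<le> s" and h_nonneg: "\<And>s. t\<^sub>1 \<le> s \<Longrightarrow> 0 \<le> h s"
    and h_ge\<^sub>1: "\<And>s. t\<^sub>2 \<le> s \<Longrightarrow> t\<^sub>1 \<le> h s" and h_ge\<^sub>2: "\<And>s. t\<^sub>3 \<le> s \<Longrightarrow> t\<^sub>2 \<le> h s"
    and delay_le: "\<And>s. t\<^sub>1 \<le> s \<Longrightarrow> B s - B (h s) \<le> r"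
    and times: "0 \<le> t\<^sub>1" "t\<^sub>1 \<le> t\<^sub>2" "t\<^sub>2 \<le> t\<^sub>3"
begin

section \<open>Comparison estimates on the clock \<open>B\<close>\<close>

lemma B_mono: "B u \<le> B v" if "0 \<le> u" "u \<le> v"
proof -
  have "0 \<le> B v - B u"
    by (rule has_integral_nonneg[OF int_B]) (use that b_nonneg in auto)
  then show ?thesis by simp
qed

text \<open>Since \<open>c\<close> lies between 0 and \<open>\<beta> * b\<close>, the integrand is
  at most \<open>\<beta> * k * b * exp B\<close>, which has the primitive
  \<open>\<beta> * k * exp B\<close>. The case \<open>k = 0\<close> gives monotonicity.\<close>

lemma increment_le:
  assumes "t\<^sub>1 \<le> u" "u \<le> v" and "\<And>s. s \<in> {u..v} \<Longrightarrow> - (y (h s)) \<le> k" and "0 \<le> k"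
  shows "exp (B v) * y v - exp (B u) * y u \<le> \<beta> * k * (exp (B v) - exp (B u))"
proof (rule has_integral_le[OF int_y[OF assms(1,2)]])
  show "((\<lambda>s. \<beta> * k * (b s * exp (B s))) has_integral \<beta> * k * (exp (B v) - exp (B u))) {u..v}"
    using assms times by (intro has_integral_mult_right int_exp_B) auto
  fix s assume s: "s \<in> {u..v}"
  then have "t\<^sub>1 \<le> s" using assms by auto
  have "- (c s * y (h s)) = c s * (- y (h s))" by simp
  also have "\<dots> \<le> c s * k" by (intro mult_left_mono assms s c_nonneg \<open>t\<^sub>1 \<le> s\<close>)
  also have "\<dots> \<le> \<beta> * b s * k" by (intro mult_right_mono assms c_le \<open>t\<^sub>1 \<le> s\<close>)
  finally have "- (c s * y (h s)) * exp (B s) \<le> \<beta> * b s * k * exp (B s)"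
    by (intro mult_right_mono) auto
  then show "- (c s * y (h s)) * exp (B s) \<le> \<beta> * k * (b s * exp (B s))"
    by (simp add: mult_ac)
qed

text \<open>The factor \<open>exp B\<close> cancels the decay of the bound, leaving
  \<open>exp \<rho> * b - b * exp B\<close> to integrate. The condition
  \<open>B v \<le> \<rho>\<close> keeps the bound nonnegative, so that \<open>c\<close> may be
  replaced by \<open>\<beta> * b\<close>.\<close>

lemma increment_le_exp:
  assumes "t\<^sub>1 \<le> u" "u \<le> v" and k: "\<And>s. s \<in> {u..v} \<Longrightarrow> - (y (h s)) \<le> \<kappa> * (exp (\<rho> - B s) - 1)"
    and "0 \<le> \<kappa>" "B v \<le> \<rho>"
  shows "exp (B v) * y v - exp (B u) * y u
    \<le> \<beta> * \<kappa> * (exp \<rho> * (B v - B u) - (exp (B v) - exp (B u)))"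
proof (rule has_integral_le[OF int_y[OF assms(1,2)]])
  show "((\<lambda>s. \<beta> * \<kappa> * (exp \<rho> * b s - b s * exp (B s))) has_integral
      \<beta> * \<kappa> * (exp \<rho> * (B v - B u) - (exp (B v) - exp (B u)))) {u..v}"
    using assms times by (intro has_integral_mult_right has_integral_diff int_exp_B int_B) auto
  fix s assume s: "s \<in> {u..v}"
  then have "t\<^sub>1 \<le> s" using assms by auto
  then have "B s \<le> B v" using s times by (intro B_mono) auto
  then have k0: "0 \<le> \<kappa> * (exp (\<rho> - B s) - 1)" using assms by simp
  have "- (c s * y (h s)) = c s * (- y (h s))" by simp
  also have "\<dots> \<le> c s * (\<kappa> * (exp (\<rho> - B s) - 1))"
    by (intro mult_left_mono k s c_nonneg \<open>t\<^sub>1 \<le> s\<close>)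
  also have "\<dots> \<le> \<beta> * b s * (\<kappa> * (exp (\<rho> - B s) - 1))"
    by (intro mult_right_mono k0 c_le \<open>t\<^sub>1 \<le> s\<close>)
  finally have "- (c s * y (h s)) * exp (B s) \<le> \<beta> * b s * (\<kappa> * (exp (\<rho> - B s) - 1)) * exp (B s)"
    by (intro mult_right_mono) auto
  also have "\<dots> = \<beta> * \<kappa> * (exp \<rho> * b s - b s * exp (B s))"
    by (simp add: exp_diff field_simps)
  finally show "- (c s * y (h s)) * exp (B s) \<le> \<beta> * \<kappa> * (exp \<rho> * b s - b s * exp (B s))" .
qed

lemma B_intermediate:
  assumes "0 \<le> u" "u \<le> v" "B u \<le> w" "w \<le> B v"
  obtains s where "u \<le> s" "s \<le> v" "B s = w"
proof -
  have "continuous_on {u..v} B" by (rule continuous_on_subset[OF cont_B]) (use assms in auto)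
  from IVT'[OF assms(3,4,2) this] show ?thesis using that by blast
qed

text \<open>Forward half of the argument: starting from the zero \<open>\<tau>\<close>, the constant
  bound is integrated for elapsed clock time up to \<open>r - ln (1 + 1 / \<beta>)\<close> and the
  decaying bound after that.\<close>

lemma after_zero_le:
  assumes "t\<^sub>1 \<le> \<tau>" "\<tau> \<le> T" "y \<tau> = 0" "0 \<le> K" "B T - B \<tau> \<le> r"
    and K: "\<And>s. s \<in> {\<tau>..T} \<Longrightarrow> - (y (h s)) \<le> K"
    and hist: "\<And>s. s \<in> {\<tau>..T} \<Longrightarrow> - (y (h s)) \<le> \<beta> * K * (exp (r + B \<tau> - B s) - 1)"
  shows "y T \<le> contraction_factor \<beta> r * K"
proof -
  \<comment> \<open>At elapsed time \<open>\<sigma>\<close> the two bounds agree, as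
    \<open>\<beta> * (exp (r - \<sigma>) - 1) = 1\<close>.\<close>
  define \<sigma> where "\<sigma> = r - ln (1 + 1 / \<beta>)"
  have "\<sigma> \<ge> 0" using r_ge by (simp add: \<sigma>_def)
  define D where "D = B T - B \<tau>"
  have BT: "B T = B \<tau> + D" by (simp add: D_def)
  show ?thesis
  proof (cases "D \<le> \<sigma>")
    case True
    have "exp (B T) * y T - exp (B \<tau>) * y \<tau> \<le> \<beta> * K * (exp (B T) - exp (B \<tau>))"
      using assms by (intro increment_le) auto
    also have "\<dots> = exp (B T) * (\<beta> * (1 - exp (- D)) * K)"
      by (simp add: BT exp_add exp_minus field_simps)
    finally have "y T \<le> \<beta> * (1 - exp (- D)) * K" using \<open>y \<tau> = 0\<close> by simp
    also have "\<dots> \<le> contraction_factor \<beta> r * K"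
      using True \<open>0 \<le> K\<close> extremal_growth_le_early[OF beta_pos, of D r]
      by (intro mult_right_mono) (auto simp: \<sigma>_def)
    finally show ?thesis .
  next
    case False
    then obtain s where s: "\<tau> \<le> s" "s \<le> T" "B s = B \<tau> + \<sigma>"
      using B_intermediate[of \<tau> T "B \<tau> + \<sigma>"] assms times \<open>\<sigma> \<ge> 0\<close> BT by auto
    have E: "exp (r - \<sigma>) = 1 + 1 / \<beta>"
      using beta_pos by (simp add: \<sigma>_def add_pos_pos)
    have "exp (B s) * y s - exp (B \<tau>) * y \<tau> \<le> \<beta> * K * (exp (B s) - exp (B \<tau>))"
      using assms s by (intro increment_le) auto
    moreover have "exp (B T) * y T - exp (B s) * y s
        \<le> \<beta> * (\<beta> * K) * (exp (r + B \<tau>) * (B T - B s) - (exp (B T) - exp (B s)))"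
      using assms s beta_pos by (intro increment_le_exp) auto
    ultimately have "exp (B T) * y T \<le> \<beta> * K * (exp (B s) - exp (B \<tau>))
        + \<beta> * (\<beta> * K) * (exp (r + B \<tau>) * (B T - B s) - (exp (B T) - exp (B s)))"
      using \<open>y \<tau> = 0\<close> by simp
    also have "\<dots> = exp (B T) * (\<beta> * (\<beta> * exp (r - D) * (D - \<sigma> + 1) - exp (- D) - \<beta>) * K)"
    proof -
      have er: "exp r = exp \<sigma> * (1 + 1 / \<beta>)" using E by (simp add: exp_diff field_simps)
      \<comment> \<open>The upper limit of the first phase and the lower limit of the second combine
        to \<open>\<beta> * exp r\<close>, which becomes the summand 1 in
        \<open>D - \<sigma> + 1\<close>.\<close>
      have b: "exp \<sigma> + \<beta> * exp \<sigma> = \<beta> * exp r" using beta_pos by (simp add: er field_simps)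
      have "\<beta> * K * (exp (B s) - exp (B \<tau>))
        + \<beta> * (\<beta> * K) * (exp (r + B \<tau>) * (B T - B s) - (exp (B T) - exp (B s)))
        = exp (B \<tau>) * (\<beta> * K) * ((exp \<sigma> + \<beta> * exp \<sigma>) - 1 + \<beta> * exp r * (D - \<sigma>) - \<beta> * exp D)"
        by (simp add: BT s(3) exp_add algebra_simps)
      also have "\<dots> = exp (B T) * (\<beta> * (\<beta> * exp (r - D) * (D - \<sigma> + 1) - exp (- D) - \<beta>) * K)"
        unfolding b by (simp add: BT exp_add exp_diff exp_minus field_simps)
      finally show ?thesis .
    qed
    finally have "y T \<le> \<beta> * (\<beta> * exp (r - D) * (D - \<sigma> + 1) - exp (- D) - \<beta>) * K" by simp
    also have "\<dots> \<le> contraction_factor \<beta> r * K"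
      using \<open>0 \<le> K\<close> extremal_growth_le[OF beta_pos, of r D]
      by (intro mult_right_mono) (auto simp: \<sigma>_def)
    finally show ?thesis .
  qed
qed

text \<open>With nonnegative delayed values \<open>exp B * y\<close> cannot increase; as
  \<open>B\<close> does not decrease and \<open>y v > 0\<close>, dropping the weight keeps the
  inequality.\<close>

lemma decreasing_le:
  assumes "t\<^sub>1 \<le> u" "u \<le> v" "0 < y v" and "\<And>s. s \<in> {u..v} \<Longrightarrow> 0 \<le> y (h s)"
  shows "y v \<le> y u"
proof -
  have "exp (B v) * y v - exp (B u) * y u \<le> \<beta> * 0 * (exp (B v) - exp (B u))"
    by (rule increment_le) (use assms in auto)
  then have *: "exp (B v) * y v \<le> exp (B u) * y u" by simp
  have "exp (B u) * y v \<le> exp (B v) * y v"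
    using assms times B_mono[of u v] by (intro mult_right_mono) auto
  with * show ?thesis by (meson exp_gt_zero mult_le_cancel_left_pos order_trans)
qed

text \<open>
  Either \<open>y\<close> has no zero since \<open>t\<^sub>2\<close>, and then it has been decreasing since \<open>t\<^sub>3\<close>, or its growth
  since its last zero is controlled by the history before that zero.
\<close>
lemma le_max:
  assumes "t\<^sub>3 \<le> T" and bound: "\<And>s. s \<in> {0..T} \<Longrightarrow> \<bar>y s\<bar> \<le> K"
  shows "y T \<le> max (contraction_factor \<beta> r * K) \<bar>y t\<^sub>3\<bar>"
proof (cases "y T \<le> 0")
  case False
  then have yT: "0 < y T" by simp
  \<comment> \<open>The supremum of \<open>Z\<close> will be the last zero: \<open>y\<close> is
    positive after it, and the intermediate value theorem gives \<open>y \<tau> = 0\<close>.\<close>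
  define Z where "Z = {s \<in> {t\<^sub>2..T}. y s \<le> 0}"
  have cont: "continuous_on {u..v} y" if "0 \<le> u" for u v
    by (rule continuous_on_subset[OF cont_y]) (use that in auto)
  show ?thesis
  proof (cases "Z = {}")
    case True
    have "y T \<le> y t\<^sub>3"
    proof (rule decreasing_le)
      fix s assume s: "s \<in> {t\<^sub>3..T}"
      then have "h s \<in> {t\<^sub>2..T}" using h_ge\<^sub>2[of s] h_le[of s] times by auto
      with True show "0 \<le> y (h s)" by (force simp: Z_def)
    qed (use assms times yT in auto)
    then show ?thesis by simp
  next
    case False
    have "closed Z"
      unfolding Z_def using times
      by (intro continuous_on_closed_Collect_le continuous_on_const closed_atLeastAtMost cont) auto
    moreover have "bdd_above Z" by (rule bdd_aboveI[of _ T]) (auto simp: Z_def)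
    ultimately have "Sup Z \<in> Z" using False by (intro closed_contains_Sup)
    define \<tau> where "\<tau> = Sup Z"
    have \<tau>: "t\<^sub>2 \<le> \<tau>" "\<tau> \<le> T" "y \<tau> \<le> 0" using \<open>Sup Z \<in> Z\<close> by (auto simp: Z_def \<tau>_def)
    have pos: "0 < y s" if "\<tau> < s" "s \<le> T" for s
    proof (rule ccontr)
      assume "\<not> 0 < y s"
      then have "s \<in> Z" using that \<tau> by (auto simp: Z_def)
      then have "s \<le> \<tau>" unfolding \<tau>_def by (rule cSup_upper[OF _ \<open>bdd_above Z\<close>])
      with that show False by simp
    qed
    have y\<tau>: "y \<tau> = 0"
    proof -
      from IVT'[OF \<tau>(3) less_imp_le[OF yT] \<tau>(2) cont] obtain z where "\<tau> \<le> z" "z \<le> T" "y z = 0"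
        using \<tau> times by auto
      with pos[of z] show ?thesis by (cases "z = \<tau>") auto
    qed
    have "0 \<le> K" using order_trans[OF abs_ge_zero bound[of T]] assms times by auto
    have K: "- y (h s) \<le> K" if "t\<^sub>1 \<le> s" "s \<le> T" for s
      using bound[of "h s"] h_nonneg[of s] h_le[of s] that by auto
    \<comment> \<open>Backward half: integrating from \<open>u\<close> to the zero limits how
      negative \<open>y u\<close> can be.\<close>
    have past: "- y u \<le> \<beta> * K * (exp (B \<tau> - B u) - 1)" if u: "t\<^sub>1 \<le> u" "u \<le> \<tau>" for u
    proof -
      have "exp (B \<tau>) * y \<tau> - exp (B u) * y u \<le> \<beta> * K * (exp (B \<tau>) - exp (B u))"
        using u K \<tau> \<open>0 \<le> K\<close> by (intro increment_le) auto
      also have "\<dots> = exp (B u) * (\<beta> * K * (exp (B \<tau> - B u) - 1))"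
        by (simp add: exp_diff field_simps)
      finally have "exp (B u) * (- y u) \<le> exp (B u) * (\<beta> * K * (exp (B \<tau> - B u) - 1))"
        using y\<tau> by simp
      then show ?thesis by (simp only: mult_le_cancel_left_pos exp_gt_zero)
    qed
    \<comment> \<open>A delayed argument before \<open>\<tau>\<close> is within clock time
      \<open>r\<close> of \<open>s\<close>, so \<open>past\<close> applies; from
      \<open>\<tau>\<close> on the delayed value is nonnegative. The \<open>max 0\<close> matters
      once more than \<open>r\<close> has elapsed since \<open>\<tau>\<close>.\<close>
    have hist: "- y (h s) \<le> \<beta> * K * max 0 (exp (r + B \<tau> - B s) - 1)" if s: "\<tau> \<le> s" "s \<le> T" for s
    proof (cases "h s < \<tau>")
      case True
      have "t\<^sub>1 \<le> h s" using h_ge\<^sub>1[of s] \<tau> s by simp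
      then have "- y (h s) \<le> \<beta> * K * (exp (B \<tau> - B (h s)) - 1)" using True by (intro past) auto
      also have "\<dots> \<le> \<beta> * K * max 0 (exp (r + B \<tau> - B s) - 1)"
      proof (rule mult_left_mono)
        have "B \<tau> - B (h s) \<le> r + B \<tau> - B s" using delay_le[of s] s \<tau> times by auto
        then show "exp (B \<tau> - B (h s)) - 1 \<le> max 0 (exp (r + B \<tau> - B s) - 1)"
          by (simp add: le_max_iff_disj)
      qed (use beta_pos \<open>0 \<le> K\<close> in auto)
      finally show ?thesis .
    next
      case False
      then have "0 \<le> y (h s)"
        using pos[of "h s"] y\<tau> h_le[of s] s \<tau> times by (cases "h s = \<tau>") auto
      moreover have "0 \<le> \<beta> * K * max 0 (exp (r + B \<tau> - B s) - 1)"
        using beta_pos \<open>0 \<le> K\<close> by (intro mult_nonneg_nonneg) auto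
      ultimately show ?thesis by linarith
    qed
    have near: "y T' \<le> contraction_factor \<beta> r * K" if T': "\<tau> \<le> T'" "T' \<le> T" "B T' - B \<tau> \<le> r" for T'
    proof (rule after_zero_le[OF _ T'(1) y\<tau> \<open>0 \<le> K\<close> T'(3)])
      fix s assume s: "s \<in> {\<tau>..T'}"
      show "- y (h s) \<le> K" using K[of s] s T' \<tau> times by auto
      have "B s \<le> B T'" using s \<tau> times by (intro B_mono) auto
      then have "max 0 (exp (r + B \<tau> - B s) - 1) = exp (r + B \<tau> - B s) - 1"
        using T'(3) by (intro max_absorb2) simp
      with hist[of s] s T' show "- y (h s) \<le> \<beta> * K * (exp (r + B \<tau> - B s) - 1)" by auto
    qed (use \<tau> times in auto)
    show ?thesis
    proof (cases "B T - B \<tau> \<le> r")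
      case True
      with near[of T] \<tau> show ?thesis by auto
    next
      case False
      have "ln (1 + 1 / \<beta>) \<ge> 0" using beta_pos by (intro ln_ge_zero) auto
      then have "0 \<le> r" using r_ge by linarith
      \<comment> \<open>From clock time \<open>r\<close> after \<open>\<tau>\<close> on,
        \<open>hist\<close> makes all delayed values nonnegative, so \<open>y T\<close> does not
        exceed \<open>y T'\<close>.\<close>
      then obtain T' where T': "\<tau> \<le> T'" "T' \<le> T" "B T' = B \<tau> + r"
        using B_intermediate[of \<tau> T "B \<tau> + r"] False \<tau> times by auto
      have "y T \<le> y T'"
      proof (rule decreasing_le)
        fix s assume s: "s \<in> {T'..T}"
        then have "B T' \<le> B s" using T' \<tau> times by (intro B_mono) auto
        then have "max 0 (exp (r + B \<tau> - B s) - 1) = 0" using T'(3) by (intro max_absorb1) simp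
        with hist[of s] s T' show "0 \<le> y (h s)" by simp
      qed (use T' \<tau> times yT in auto)
      with near[of T'] T' show ?thesis by auto
    qed
  qed
next
  case True
  then have "y T \<le> \<bar>y t\<^sub>3\<bar>" using abs_ge_zero[of "y t\<^sub>3"] by linarith
  then show ?thesis by simp
qed

text \<open>Linearity; applied to \<open>- y\<close>, the one-sided \<open>le_max\<close> yields a
  bound on \<open>\<bar>y\<bar>\<close>.\<close>

lemma weighted_delay_equation_uminus:
  "weighted_delay_equation (\<lambda>s. - y s) B b c h \<beta> r t\<^sub>1 t\<^sub>2 t\<^sub>3"
proof unfold_locales
  show "continuous_on {0..} (\<lambda>s. - y s)" by (intro continuous_on_minus cont_y)
  show "((\<lambda>s. - (c s * - y (h s)) * exp (B s)) has_integral exp (B v) * - y v - exp (B u) * - y u) {u..v}"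
    if "t\<^sub>1 \<le> u" "u \<le> v" for u v
    using has_integral_neg[OF int_y[OF that]] by simp
qed (use beta_pos r_ge cont_B b_nonneg int_B int_exp_B c_nonneg c_le h_le h_nonneg h_ge\<^sub>1 h_ge\<^sub>2
       delay_le times in auto)

text \<open>At a maximum point \<open>T\<close> of \<open>\<bar>y\<bar>\<close> on
  \<open>{0..t}\<close>, \<open>le_max\<close> applies with the bound
  \<open>\<bar>y T\<bar>\<close>. If this value exceeded \<open>K\<close>, it would be at most the
  larger of two strictly smaller numbers.\<close>

theorem bounded_by_history:
  assumes contr: "contraction_factor \<beta> r < 1"
    and init: "\<And>s. s \<in> {0..t\<^sub>3} \<Longrightarrow> \<bar>y s\<bar> \<le> K" and "0 \<le> t"
  shows "\<bar>y t\<bar> \<le> K"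
proof (rule ccontr)
  assume "\<not> \<bar>y t\<bar> \<le> K"
  have "continuous_on {0..t} (\<lambda>s. \<bar>y s\<bar>)"
    by (intro continuous_on_rabs continuous_on_subset[OF cont_y]) auto
  then obtain T where T: "T \<in> {0..t}" and max: "\<And>s. s \<in> {0..t} \<Longrightarrow> \<bar>y s\<bar> \<le> \<bar>y T\<bar>"
    using continuous_attains_sup[of "{0..t}" "\<lambda>s. \<bar>y s\<bar>"] \<open>0 \<le> t\<close> by auto
  have "\<bar>y t\<bar> \<le> \<bar>y T\<bar>" using \<open>0 \<le> t\<close> by (intro max) simp
  with \<open>\<not> \<bar>y t\<bar> \<le> K\<close> have "K < \<bar>y T\<bar>" by linarith
  have "0 \<le> K" using order_trans[OF abs_ge_zero init[of t\<^sub>3]] times by auto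
  have "t\<^sub>3 \<le> T" using init[of T] \<open>K < \<bar>y T\<bar>\<close> T by force
  interpret neg: weighted_delay_equation "\<lambda>s. - y s" B b c h \<beta> r t\<^sub>1 t\<^sub>2 t\<^sub>3
    by (rule weighted_delay_equation_uminus)
  have "y T \<le> max (contraction_factor \<beta> r * \<bar>y T\<bar>) \<bar>y t\<^sub>3\<bar>"
    using T max by (intro le_max \<open>t\<^sub>3 \<le> T\<close>) auto
  moreover have "- y T \<le> max (contraction_factor \<beta> r * \<bar>y T\<bar>) \<bar>- y t\<^sub>3\<bar>"
    using T max by (intro neg.le_max \<open>t\<^sub>3 \<le> T\<close>) auto
  ultimately have "\<bar>y T\<bar> \<le> max (contraction_factor \<beta> r * \<bar>y T\<bar>) \<bar>y t\<^sub>3\<bar>"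
    by (intro abs_leI) auto
  moreover have "contraction_factor \<beta> r * \<bar>y T\<bar> < \<bar>y T\<bar>"
    using mult_strict_right_mono[OF contr, of "\<bar>y T\<bar>"] \<open>0 \<le> K\<close> \<open>K < \<bar>y T\<bar>\<close> by linarith
  moreover have "\<bar>y t\<^sub>3\<bar> < \<bar>y T\<bar>" using init[of t\<^sub>3] times \<open>K < \<bar>y T\<bar>\<close> by auto
  ultimately show False by simp
qed

end

section \<open>Perturbation of the parameters\<close>

text \<open>A strict inequality survives a small increase of both parameters. The gain later absorbs
  the exponential weight and the passage from limits superior to eventual bounds.\<close>

lemma perturbed_delay_parameters:
  fixes \<beta> h\<^sub>0 :: real
  assumes "\<beta> = 0 \<or> (1 / \<beta>) * exp (- h\<^sub>0) > ln ((\<beta>\<^sup>2 + \<beta>) / (\<beta>\<^sup>2 + 1))"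
  obtains \<beta>' r where "0 < \<beta>'" "\<beta> < \<beta>'" "h\<^sub>0 < r" "ln (1 + 1 / \<beta>') \<le> r" "contraction_factor \<beta>' r < 1"
proof -
  obtain \<beta>' h' where p: "0 < \<beta>'" "\<beta> < \<beta>'" "h\<^sub>0 < h'"
      "(1 / \<beta>') * exp (- h') > ln ((\<beta>'\<^sup>2 + \<beta>') / (\<beta>'\<^sup>2 + 1))"
  proof (cases "\<beta> \<le> 0")
    case True
    \<comment> \<open>At \<open>\<beta>' = 1\<close> the logarithm is \<open>ln 1 = 0\<close>, so
      any delay bound is admissible.\<close>
    show thesis by (rule that[of 1 "h\<^sub>0 + 1"]) (use True in auto)
  next
    case False
    \<comment> \<open>Both parameters are shifted by the same \<open>x\<close>; continuity at 0 from
      the right keeps the gap \<open>F\<close> positive.\<close>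
    define F where "F x = (1 / (\<beta> + x)) * exp (- (h\<^sub>0 + x))
        - ln (((\<beta> + x)\<^sup>2 + (\<beta> + x)) / ((\<beta> + x)\<^sup>2 + 1))" for x
    have pos: "\<beta>\<^sup>2 + 1 > 0" "\<beta>\<^sup>2 + \<beta> > 0" using False by (auto intro: add_nonneg_pos)
    have "(F \<longlongrightarrow> (1 / (\<beta> + 0)) * exp (- (h\<^sub>0 + 0))
        - ln (((\<beta> + 0)\<^sup>2 + (\<beta> + 0)) / ((\<beta> + 0)\<^sup>2 + 1))) (at_right 0)"
      unfolding F_def by (intro tendsto_intros) (use False pos in auto)
    moreover have "0 < (1 / (\<beta> + 0)) * exp (- (h\<^sub>0 + 0))
        - ln (((\<beta> + 0)\<^sup>2 + (\<beta> + 0)) / ((\<beta> + 0)\<^sup>2 + 1))"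
      using assms False by auto
    ultimately have "\<forall>\<^sub>F x in at_right 0. 0 < F x" by (rule order_tendstoD(1))
    then have "\<forall>\<^sub>F x in at_right 0. 0 < x \<and> 0 < F x"
      by (intro eventually_conj eventually_at_right_less)
    then obtain x where "0 < x" "0 < F x"
      using eventually_happens[of _ "at_right (0::real)"] by auto
    then show thesis by (intro that[of "\<beta> + x" "h\<^sub>0 + x"]) (use False in \<open>auto simp: F_def\<close>)
  qed
  \<comment> \<open>Raising \<open>r\<close> to \<open>ln (1 + 1 / \<beta>')\<close> preserves the
    inequality: there \<open>exp (- r) / \<beta>'\<close> is \<open>1 / (\<beta>' + 1)\<close>,
    which exceeds the logarithm by \<open>ln z \<le> z - 1\<close>.\<close>
  define r where "r = max h' (ln (1 + 1 / \<beta>'))"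
  have "(1 / \<beta>') * exp (- r) > ln ((\<beta>'\<^sup>2 + \<beta>') / (\<beta>'\<^sup>2 + 1))"
  proof (cases "h' \<ge> ln (1 + 1 / \<beta>')")
    case True
    then show ?thesis using p(4) by (simp add: r_def)
  next
    case False
    have pos: "\<beta>'\<^sup>2 + \<beta>' > 0" "\<beta>'\<^sup>2 + 1 > 0" using p(1) by (auto intro: add_pos_pos add_nonneg_pos)
    have "ln ((\<beta>'\<^sup>2 + \<beta>') / (\<beta>'\<^sup>2 + 1)) \<le> (\<beta>'\<^sup>2 + \<beta>') / (\<beta>'\<^sup>2 + 1) - 1"
      using pos by (intro ln_le_minus_one) auto
    also have "\<dots> = (\<beta>' - 1) / (\<beta>'\<^sup>2 + 1)" using pos by (simp add: field_simps)
    also have "\<dots> < 1 / (\<beta>' + 1)"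
      using pos p(1) by (simp add: divide_simps) (simp add: algebra_simps power2_eq_square)
    also have "\<dots> = (1 / \<beta>') * (1 / (1 + 1 / \<beta>'))" using p(1) by (simp add: field_simps)
    also have "\<dots> = (1 / \<beta>') * exp (- ln (1 + 1 / \<beta>'))"
      using p(1) by (simp add: exp_minus add_pos_pos inverse_eq_divide)
    finally show ?thesis using False by (simp add: r_def)
  qed
  then have "contraction_factor \<beta>' r < 1" by (rule contraction_factor_less_1[OF p(1)])
  then show thesis by (intro that[of \<beta>' r] p) (use p in \<open>auto simp: r_def\<close>)
qed

text \<open>At \<open>\<alpha> = 0\<close> the inequality is strict, so continuity gives a small
  positive exponent. The weight \<open>exp (\<alpha> * A)\<close> will enlarge the delayed
  coefficient by a factor at most \<open>exp (\<alpha> * r)\<close> and reduce the damping to the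
  fraction \<open>1 - \<alpha>\<close>.\<close>

lemma small_exponent:
  fixes \<beta>\<^sub>1 \<beta>' r :: real
  assumes "\<beta>\<^sub>1 < \<beta>'"
  obtains \<alpha> where "0 < \<alpha>" "\<alpha> < 1" "\<beta>\<^sub>1 * exp (\<alpha> * r) \<le> \<beta>' * (1 - \<alpha>)"
proof -
  have "((\<lambda>x. \<beta>' * (1 - x) - \<beta>\<^sub>1 * exp (x * r)) \<longlongrightarrow> \<beta>' * (1 - 0) - \<beta>\<^sub>1 * exp (0 * r)) (at_right 0)"
    by (intro tendsto_intros)
  then have "\<forall>\<^sub>F x in at_right 0. 0 < \<beta>' * (1 - x) - \<beta>\<^sub>1 * exp (x * r)"
    by (rule order_tendstoD(1)) (use assms in auto)
  moreover have "\<forall>\<^sub>F x::real in at_right 0. x < 1"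
    by (rule eventually_at_right_real[of 0 1, THEN eventually_mono]) auto
  ultimately have "\<forall>\<^sub>F x in at_right 0. 0 < x \<and> x < 1 \<and> 0 < \<beta>' * (1 - x) - \<beta>\<^sub>1 * exp (x * r)"
    by (intro eventually_conj eventually_at_right_less)
  then obtain x where "0 < x" "x < 1" "0 < \<beta>' * (1 - x) - \<beta>\<^sub>1 * exp (x * r)"
    using eventually_happens[of _ "at_right (0::real)"] by auto
  then show thesis by (intro that[of x]) auto
qed

section \<open>Estimates for solutions\<close>

lemma AE_lebesgue_on_negligible:
  assumes "AE t in lebesgue_on {0::real..}. P t"
  obtains N where "negligible N" "\<And>t. 0 \<le> t \<Longrightarrow> t \<notin> N \<Longrightarrow> P t"
proof -
  have "AE t in lebesgue. t \<in> {0::real..} \<longrightarrow> P t"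
    using assms by (subst (asm) AE_restrict_space_iff) auto
  then obtain N where "negligible N" "{t. \<not> (t \<in> {0..} \<longrightarrow> P t)} \<subseteq> N"
    unfolding eventually_ae_filter_negligible by blast
  then show thesis by (intro that[of N]) auto
qed

lemma has_integral_abs_le_negligible:
  fixes g :: "real \<Rightarrow> real"
  assumes "(g has_integral I) {u..v}" "u \<le> v" "negligible N" "0 \<le> C"
    and "\<And>s. s \<in> {u..v} - N \<Longrightarrow> \<bar>g s\<bar> \<le> C"
  shows "\<bar>I\<bar> \<le> C * (v - u)"
proof -
  have "((\<lambda>s. if s \<in> N then 0 else g s) has_integral I) {u..v}"
    by (rule has_integral_spike[OF assms(3) _ assms(1)]) auto
  from has_integral_bound_real[OF \<open>0 \<le> C\<close> finite.emptyI this] show ?thesis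
    using assms by auto
qed

lemma continuous_on_absolutely_continuous:
  assumes "\<And>c d. 0 \<le> c \<Longrightarrow> c \<le> d \<Longrightarrow> absolutely_continuous_on_interval f c d"
  shows "continuous_on {0..} f"
  unfolding continuous_on_iff
proof (intro ballI allI impI)
  fix t e :: real assume t: "t \<in> {0..}" and "e > 0"
  with assms[of 0 "t + 1"] obtain \<delta> where "\<delta> > 0" and \<delta>: "\<And>(n::nat) u v.
      (\<forall>i<n. 0 \<le> u i \<and> u i \<le> v i \<and> v i \<le> t + 1) \<Longrightarrow>
      disjoint_family_on (\<lambda>i. {u i<..<v i}) {..<n} \<Longrightarrow>
      (\<Sum>i<n. v i - u i) < \<delta> \<Longrightarrow> (\<Sum>i<n. \<bar>f (v i) - f (u i)\<bar>) < e"
    unfolding absolutely_continuous_on_interval_def by (auto 4 3)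
  have "\<bar>f s - f t\<bar> < e" if "0 \<le> s" "\<bar>s - t\<bar> < min \<delta> 1" for s
  proof -
    \<comment> \<open>The definition is applied to the single interval between \<open>s\<close> and
      \<open>t\<close>, which the radius \<open>min \<delta> 1\<close> keeps inside
      \<open>{0..t + 1}\<close>.\<close>
    have "(\<Sum>i<1::nat. \<bar>f (max s t) - f (min s t)\<bar>) < e"
      by (rule \<delta>) (use that t in \<open>auto simp: disjoint_family_on_def\<close>)
    then show ?thesis by (cases "s \<le> t") (auto simp: abs_minus_commute)
  qed
  then show "\<exists>d>0. \<forall>s\<in>{0..}. dist s t < d \<longrightarrow> dist (f s) (f t) < e"
    using \<open>\<delta> > 0\<close> by (intro exI[of _ "min \<delta> 1"]) (auto simp: dist_real_def)
qed

lemma initial_function_le_norm: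
  assumes "initial_function \<phi>" "t \<le> 0"
  shows "\<bar>\<phi> t\<bar> \<le> initial_norm \<phi>"
proof -
  from assms obtain C where "\<And>t. t \<le> 0 \<Longrightarrow> \<bar>\<phi> t\<bar> \<le> C"
    unfolding initial_function_def bounded_iff by auto
  then have "bdd_above ((\<lambda>t. \<bar>\<phi> t\<bar>) ` {..0})" by (intro bdd_aboveI2) auto
  then show ?thesis unfolding initial_norm_def using assms(2) by (intro cSUP_upper) auto
qed

section \<open>The clock \<open>A\<close> of an essentially bounded coefficient\<close>

locale bounded_coefficients =
  fixes a b h :: "real \<Rightarrow> real" and C\<^sub>a C\<^sub>b :: real and N :: "real set"
  assumes measurable_a: "a \<in> borel_measurable (lebesgue_on {0..})"
    and N: "negligible N"
    and a_le: "\<And>t. 0 \<le> t \<Longrightarrow> t \<notin> N \<Longrightarrow> \<bar>a t\<bar> \<le> C\<^sub>a"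
    and b_le: "\<And>t. 0 \<le> t \<Longrightarrow> t \<notin> N \<Longrightarrow> \<bar>b t\<bar> \<le> C\<^sub>b"
    and C_nonneg: "0 \<le> C\<^sub>a" "0 \<le> C\<^sub>b"
    and h_le: "\<And>t. 0 \<le> t \<Longrightarrow> h t \<le> t"
begin

definition A :: "real \<Rightarrow> real" where "A t = integral {0..t} a"

lemma absolutely_integrable_a: "a absolutely_integrable_on {u..v}" if "0 \<le> u"
proof (rule measurable_bounded_by_integrable_imp_absolutely_integrable)
  show "a \<in> borel_measurable (lebesgue_on {u..v})"
    by (rule measurable_restrict_mono[OF measurable_a]) (use that in auto)
  \<comment> \<open>The dominating function is the constant bound off \<open>N\<close>; on
    \<open>N\<close>, where that bound may fail, it is \<open>\<bar>a\<bar>\<close> itself, which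
    does not affect integrability.\<close>
  show "(\<lambda>t. if t \<in> N then \<bar>a t\<bar> else C\<^sub>a) integrable_on {u..v}"
    by (rule integrable_spike[OF integrable_const_ivl N]) auto
  show "norm (a t) \<le> (if t \<in> N then \<bar>a t\<bar> else C\<^sub>a)" if "t \<in> {u..v}" for t
    using a_le[of t] that \<open>0 \<le> u\<close> by auto
qed auto

lemma integral_a: "integral {u..v} a = A v - A u" if "0 \<le> u" "u \<le> v"
  using Henstock_Kurzweil_Integration.integral_combine[of 0 u v a]
    set_lebesgue_integral_eq_integral(1)[OF absolutely_integrable_a[of 0 v]] that
  by (simp add: A_def)

lemma has_integral_a: "(a has_integral A v - A u) {u..v}" if "0 \<le> u" "u \<le> v"
  using integral_a[OF that] set_lebesgue_integral_eq_integral(1)[OF absolutely_integrable_a, of u v] that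
  by (simp add: has_integral_iff)

lemma lipschitz_A: "C\<^sub>a-lipschitz_on {0..} A"
proof (rule lipschitz_on_leI)
  fix u v :: real assume "u \<in> {0..}" "v \<in> {0..}" "u \<le> v"
  then have "\<bar>A v - A u\<bar> \<le> C\<^sub>a * (v - u)"
    using a_le by (intro has_integral_abs_le_negligible[OF has_integral_a _ N]) (auto simp: C_nonneg)
  with \<open>u \<le> v\<close> show "dist (A u) (A v) \<le> C\<^sub>a * dist u v" by (simp add: dist_real_def)
qed (rule C_nonneg)

lemma has_integral_a_exp:
  assumes "0 \<le> u" "u \<le> v"
  shows "((\<lambda>s. \<kappa> * a s * exp (\<kappa> * A s)) has_integral exp (\<kappa> * A v) - exp (\<kappa> * A u)) {u..v}"
proof -
  have cont: "continuous_on {u..v} A"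
    using lipschitz_on_continuous_on[OF lipschitz_A] by (rule continuous_on_subset) (use assms in auto)
  then have "bounded ((\<lambda>s. exp (\<kappa> * A s) * \<kappa>) ` {u..v})"
    by (intro compact_imp_bounded compact_continuous_image continuous_intros) auto
  then obtain C where "\<forall>p\<in>(\<lambda>s. exp (\<kappa> * A s) * \<kappa>) ` {u..v}. norm p \<le> C"
    unfolding bounded_iff by (rule exE)
  then have C: "\<bar>exp (\<kappa> * A s) * \<kappa>\<bar> \<le> C" if "s \<in> {u..v}" for s
    using that unfolding real_norm_def by (rule bspec[OF _ imageI])
  have "((\<lambda>s. exp (\<kappa> * A s) * \<kappa> * a s) has_integral exp (\<kappa> * A v) - exp (\<kappa> * A u)) {u..v}"
  proof (rule has_integral_chain_rule[OF assms(2), where f = A and \<Phi> = "\<lambda>p. exp (\<kappa> * p)"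
        and \<Phi>' = "\<lambda>s w. exp (\<kappa> * A s) * \<kappa> * w"])
    show "C\<^sub>a-lipschitz_on {u..v} A"
      using lipschitz_A by (rule lipschitz_on_subset) (use assms in auto)
    show "(a has_integral A v' - A u') {u'..v'}" if "u \<le> u'" "u' \<le> v'" for u' v'
      using that assms by (intro has_integral_a) auto
    show "((\<lambda>p. exp (\<kappa> * p)) has_derivative (\<lambda>w. exp (\<kappa> * A s) * \<kappa> * w)) (at (A s))" for s
      by (auto intro!: derivative_eq_intros simp: fun_eq_iff)
    show "\<bar>exp (\<kappa> * A s) * \<kappa> * w\<bar> \<le> C * norm w" if "s \<in> {u..v}" for s w
      using mult_right_mono[OF C[OF that], of "\<bar>w\<bar>"] by (simp add: abs_mult)
  qed
  then show ?thesis by (simp add: mult_ac)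
qed

end

text \<open>Makes the pair of \<open>x\<close> and \<open>A\<close> an indefinite integral, so that
  the chain rule covers products.\<close>

lemma has_integral_Pair:
  fixes f :: "'n::euclidean_space \<Rightarrow> 'a::real_normed_vector" and g :: "'n \<Rightarrow> 'b::real_normed_vector"
  assumes "(f has_integral i) S" "(g has_integral j) S"
  shows "((\<lambda>x. (f x, g x)) has_integral (i, j)) S"
proof -
  have "bounded_linear (\<lambda>p. (p, 0) :: 'a \<times> 'b)" "bounded_linear (\<lambda>q. (0, q) :: 'a \<times> 'b)"
    by (intro bounded_linear_Pair bounded_linear_ident bounded_linear_zero)+
  from has_integral_add[OF has_integral_linear[OF assms(1) this(1)] has_integral_linear[OF assms(2) this(2)]]
  show ?thesis by (simp add: o_def)
qed

locale bounded_coefficients_solution = bounded_coefficients +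
  fixes \<phi> x :: "real \<Rightarrow> real"
  assumes initial: "initial_function \<phi>" and solution: "delay_solution a b h \<phi> x"
begin

lemma continuous_x: "continuous_on {0..} x"
  using solution by (intro continuous_on_absolutely_continuous) (simp add: delay_solution_def)

lemma history_le: "\<bar>x t\<bar> \<le> initial_norm \<phi>" if "t \<le> 0"
  using initial_function_le_norm[OF initial that] solution that by (simp add: delay_solution_def)

lemma initial_norm_nonneg: "0 \<le> initial_norm \<phi>"
  using history_le[of 0] abs_ge_zero[of "x 0"] by linarith

lemma has_integral_x:
  assumes "0 \<le> u" "u \<le> v"
  shows "((\<lambda>s. - a s * x s - b s * x (h s)) has_integral x v - x u) {u..v}"
proof -
  have "AE t in lebesgue_on {0..}. \<exists>x'. (x has_real_derivative x') (at t) \<and>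
      x' + a t * x t + b t * x (h t) = 0"
    using solution by (simp add: delay_solution_def)
  then obtain N' where N': "negligible N'" "\<And>t. 0 \<le> t \<Longrightarrow> t \<notin> N' \<Longrightarrow>
      \<exists>x'. (x has_real_derivative x') (at t) \<and> x' + a t * x t + b t * x (h t) = 0"
    by (rule AE_lebesgue_on_negligible) (rule that)
  show ?thesis
  proof (rule absolutely_continuous_has_integral[OF _ assms(2) N'(1)])
    show "absolutely_continuous_on_interval x u v"
      using solution assms by (simp add: delay_solution_def)
    fix t assume "t \<in> {u..v} - N'"
    with N'(2)[of t] assms obtain x' where
      "(x has_real_derivative x') (at t)" "x' + a t * x t + b t * x (h t) = 0" by auto
    moreover from this have "x' = - a t * x t - b t * x (h t)" by linarith
    ultimately show "(x has_real_derivative - a t * x t - b t * x (h t)) (at t)" by simp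
  qed
qed

lemma increment_x_le:
  assumes "0 \<le> u" "u \<le> v" and K: "initial_norm \<phi> \<le> K" "\<And>s. s \<in> {0..v} \<Longrightarrow> \<bar>x s\<bar> \<le> K"
  shows "\<bar>x v - x u\<bar> \<le> (C\<^sub>a + C\<^sub>b) * K * (v - u)"
proof (rule has_integral_abs_le_negligible[OF has_integral_x[OF assms(1,2)] assms(2) N])
  have "0 \<le> K" using initial_norm_nonneg K(1) by linarith
  then show "0 \<le> (C\<^sub>a + C\<^sub>b) * K" using C_nonneg by simp
  fix s assume s: "s \<in> {u..v} - N"
  then have "0 \<le> s" using assms by auto
  have "\<bar>x (h s)\<bar> \<le> K"
    using K(1) K(2)[of "h s"] history_le[of "h s"] h_le[OF \<open>0 \<le> s\<close>] s by (cases "h s \<le> 0") auto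
  then have "\<bar>b s * x (h s)\<bar> \<le> C\<^sub>b * K"
    unfolding abs_mult using b_le[of s] s \<open>0 \<le> s\<close> C_nonneg by (intro mult_mono) auto
  moreover have "\<bar>a s * x s\<bar> \<le> C\<^sub>a * K"
    unfolding abs_mult using a_le[of s] K(2)[of s] s \<open>0 \<le> s\<close> C_nonneg by (intro mult_mono) auto
  ultimately show "\<bar>- a s * x s - b s * x (h s)\<bar> \<le> (C\<^sub>a + C\<^sub>b) * K"
    by (simp add: distrib_right)
qed

text \<open>Each time step of length \<open>1 / (2 * (C\<^sub>a + C\<^sub>b + 1))\<close> at most
  doubles the bound. This a priori estimate has constants independent of \<open>\<phi>\<close> and
  will provide the history bound on \<open>{0..t\<^sub>3}\<close>.\<close>

lemma growth_le:
  assumes "0 \<le> t" "t \<le> real n / (2 * (C\<^sub>a + C\<^sub>b + 1))"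
  shows "\<bar>x t\<bar> \<le> 2 ^ n * initial_norm \<phi>"
  using assms
proof (induction n arbitrary: t)
  case 0
  then show ?case using history_le[of t] by simp
next
  case (Suc n)
  define C where "C = C\<^sub>a + C\<^sub>b"
  have "0 \<le> C" using C_nonneg by (simp add: C_def)
  define u where "u = real n / (2 * (C + 1))"
  have u: "0 \<le> u" using \<open>0 \<le> C\<close> by (simp add: u_def)
  have IH: "\<bar>x s\<bar> \<le> 2 ^ n * initial_norm \<phi>" if "0 \<le> s" "s \<le> u" for s
    using Suc.IH[of s] that by (simp add: u_def C_def)
  have "continuous_on {0..t} (\<lambda>s. \<bar>x s\<bar>)"
    by (intro continuous_on_rabs continuous_on_subset[OF continuous_x]) auto
  then obtain T where T: "T \<in> {0..t}" and max: "\<And>s. s \<in> {0..t} \<Longrightarrow> \<bar>x s\<bar> \<le> \<bar>x T\<bar>"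
    using continuous_attains_sup[of "{0..t}" "\<lambda>s. \<bar>x s\<bar>"] Suc.prems by auto
  have "\<bar>x T\<bar> \<le> 2 ^ Suc n * initial_norm \<phi>"
  proof (cases "T \<le> u")
    case True
    then have "\<bar>x T\<bar> \<le> 2 ^ n * initial_norm \<phi>" using T by (intro IH) auto
    moreover have "0 \<le> 2 ^ n * initial_norm \<phi>" using initial_norm_nonneg by simp
    ultimately show ?thesis by simp
  next
    case False
    \<comment> \<open>\<open>K\<close> bounds the solution and its history up to \<open>T\<close>,
      and over one step \<open>x\<close> moves by at most \<open>K / 2\<close>; this half is
      absorbed on the left.\<close>
    define K where "K = max (initial_norm \<phi>) \<bar>x T\<bar>"
    have "0 \<le> K" by (simp add: K_def le_max_iff_disj)
    have "\<bar>x T - x u\<bar> \<le> C * K * (T - u)"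
      unfolding C_def using False T u max by (intro increment_x_le) (auto simp: K_def le_max_iff_disj)
    also have "\<dots> \<le> K / 2"
    proof -
      have "T \<le> real (Suc n) / (2 * (C + 1))"
        using T Suc.prems(2) unfolding C_def by (auto intro: order_trans)
      then have "T - u \<le> (real (Suc n) - real n) / (2 * (C + 1))"
        unfolding u_def diff_divide_distrib by linarith
      then have "C * (T - u) \<le> C * (1 / (2 * (C + 1)))" using \<open>0 \<le> C\<close> by (intro mult_left_mono) auto
      also have "\<dots> \<le> 1 / 2" using \<open>0 \<le> C\<close> by (simp add: field_simps)
      finally have "K * (C * (T - u)) \<le> K * (1 / 2)" using \<open>0 \<le> K\<close> by (rule mult_left_mono)
      then show ?thesis by (simp add: mult_ac)
    qed
    finally have "\<bar>x T\<bar> \<le> \<bar>x u\<bar> + K / 2" by linarith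
    then have "\<bar>x T\<bar> \<le> 2 ^ n * initial_norm \<phi> + K / 2" using IH[of u] u by simp
    moreover have "initial_norm \<phi> \<le> 2 ^ n * initial_norm \<phi>"
      using mult_right_mono[of 1 "2 ^ n" "initial_norm \<phi>"] initial_norm_nonneg by simp
    ultimately show ?thesis using initial_norm_nonneg
      by (cases "initial_norm \<phi> \<le> \<bar>x T\<bar>") (auto simp: K_def)
  qed
  with max[of t] Suc.prems show ?case by auto
qed

text \<open>The chain rule for \<open>exp q * p\<close> along \<open>p = x\<close>,
  \<open>q = A\<close> acts as a product rule, and the terms with \<open>a s * x s\<close>
  cancel.\<close>

lemma has_integral_exp_A_x:
  assumes "0 \<le> u" "u \<le> v"
  shows "((\<lambda>s. - (b s * x (h s)) * exp (A s)) has_integral exp (A v) * x v - exp (A u) * x u) {u..v}"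
proof -
  have "compact (x ` {0..v})" "compact (A ` {u..v})"
    using assms
    by (auto intro!: compact_continuous_image continuous_on_subset[OF continuous_x]
          continuous_on_subset[OF lipschitz_on_continuous_on[OF lipschitz_A]])
  then obtain X Y where X: "\<And>s. s \<in> {0..v} \<Longrightarrow> \<bar>x s\<bar> \<le> X" and Y: "\<And>s. s \<in> {u..v} \<Longrightarrow> \<bar>A s\<bar> \<le> Y"
    by (metis (no_types, lifting) bounded_iff compact_imp_bounded imageI real_norm_def)
  define K where "K = max X (initial_norm \<phi>)"
  have "0 \<le> K" using initial_norm_nonneg by (simp add: K_def le_max_iff_disj)
  have K: "\<bar>x s\<bar> \<le> K" if "s \<in> {0..v}" for s using X[OF that] by (simp add: K_def)
  have lip: "((C\<^sub>a + C\<^sub>b) * K)-lipschitz_on {u..v} x"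
  proof (rule lipschitz_on_leI)
    show "0 \<le> (C\<^sub>a + C\<^sub>b) * K" using C_nonneg \<open>0 \<le> K\<close> by simp
    fix s t assume st: "s \<in> {u..v}" "t \<in> {u..v}" "s \<le> t"
    then have "\<bar>x t - x s\<bar> \<le> (C\<^sub>a + C\<^sub>b) * K * (t - s)"
      using assms K by (intro increment_x_le) (auto simp: K_def)
    with \<open>s \<le> t\<close> show "dist (x s) (x t) \<le> (C\<^sub>a + C\<^sub>b) * K * dist s t"
      by (simp add: dist_real_def abs_minus_commute)
  qed
  let ?\<Phi> = "\<lambda>p::real \<times> real. exp (snd p) * fst p"
  have "((\<lambda>s. exp (A s) * x s * a s + exp (A s) * (- a s * x s - b s * x (h s)))
      has_integral ?\<Phi> (x v, A v) - ?\<Phi> (x u, A u)) {u..v}"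
  proof (rule has_integral_chain_rule[OF assms(2), where f = "\<lambda>s. (x s, A s)"
        and g = "\<lambda>s. (- a s * x s - b s * x (h s), a s)"
        and \<Phi>' = "\<lambda>s w. exp (A s) * x s * snd w + exp (A s) * fst w", simplified fst_conv snd_conv])
    show "(sqrt (((C\<^sub>a + C\<^sub>b) * K)\<^sup>2 + C\<^sub>a\<^sup>2))-lipschitz_on {u..v} (\<lambda>s. (x s, A s))"
      using assms by (intro lipschitz_on_Pair lip lipschitz_on_subset[OF lipschitz_A]) auto
    show "((\<lambda>s. (- a s * x s - b s * x (h s), a s)) has_integral (x v', A v') - (x u', A u')) {u'..v'}"
      if "u \<le> u'" "u' \<le> v'" for u' v'
      unfolding diff_Pair using that assms
      by (intro has_integral_Pair has_integral_x has_integral_a) auto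
    show "(?\<Phi> has_derivative (\<lambda>w. exp (A s) * x s * snd w + exp (A s) * fst w)) (at (x s, A s))" for s
      by (auto intro!: derivative_eq_intros simp: fun_eq_iff algebra_simps)
    fix s and w :: "real \<times> real" assume s: "s \<in> {u..v}"
    have "\<bar>exp (A s) * x s * snd w + exp (A s) * fst w\<bar> \<le> exp (A s) * (\<bar>x s\<bar> * \<bar>snd w\<bar> + \<bar>fst w\<bar>)"
      by (simp add: distrib_left order_trans[OF abs_triangle_ineq] abs_mult)
    also have "\<dots> \<le> exp Y * (K * norm w + norm w)"
    proof (intro mult_mono add_mono)
      show "exp (A s) \<le> exp Y" using Y[OF s] by simp
      show "\<bar>x s\<bar> \<le> K" using K s assms by auto
      show "\<bar>snd w\<bar> \<le> norm w" "\<bar>fst w\<bar> \<le> norm w"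
        using norm_snd_le[of "snd w" "fst w"] norm_fst_le[of "fst w" "snd w"] by auto
    qed (use \<open>0 \<le> K\<close> in auto)
    finally show "\<bar>exp (A s) * x s * snd w + exp (A s) * fst w\<bar> \<le> exp Y * (K + 1) * norm w"
      by (simp add: algebra_simps)
  qed
  then show ?thesis by (simp add: algebra_simps)
qed

end

text \<open>For \<open>y = exp (\<alpha> * A) * x\<close> the damping becomes
  \<open>(1 - \<alpha>) * a\<close> and the delayed coefficient gains the factor
  \<open>exp (\<alpha> * (A s - A (h s)))\<close>; the choice of \<open>\<alpha>\<close> keeps the
  latter coefficient at most \<open>\<beta>'\<close> times the damping.\<close>

lemma (in bounded_coefficients_solution) weighted_solution:
  fixes \<alpha> \<beta>\<^sub>1 \<beta>' r t\<^sub>1 t\<^sub>2 t\<^sub>3 :: real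
  assumes \<alpha>: "0 < \<alpha>" "\<alpha> < 1" "\<beta>\<^sub>1 * exp (\<alpha> * r) \<le> \<beta>' * (1 - \<alpha>)" "0 \<le> \<beta>\<^sub>1"
    and \<beta>': "0 < \<beta>'" "ln (1 + 1 / \<beta>') \<le> r"
    and nonneg: "\<And>t. 0 \<le> t \<Longrightarrow> 0 \<le> a t" "\<And>t. 0 \<le> t \<Longrightarrow> 0 \<le> b t"
    and t\<^sub>1: "\<And>s. t\<^sub>1 \<le> s \<Longrightarrow> b s \<le> \<beta>\<^sub>1 * a s" "\<And>s. t\<^sub>1 \<le> s \<Longrightarrow> 0 \<le> h s"
      "\<And>s. t\<^sub>1 \<le> s \<Longrightarrow> A s - A (h s) \<le> r"
    and "\<And>s. t\<^sub>2 \<le> s \<Longrightarrow> t\<^sub>1 \<le> h s" "\<And>s. t\<^sub>3 \<le> s \<Longrightarrow> t\<^sub>2 \<le> h s"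
    and times: "0 \<le> t\<^sub>1" "t\<^sub>1 \<le> t\<^sub>2" "t\<^sub>2 \<le> t\<^sub>3"
  shows "weighted_delay_equation (\<lambda>s. exp (\<alpha> * A s) * x s) (\<lambda>s. (1 - \<alpha>) * A s) (\<lambda>s. (1 - \<alpha>) * a s)
    (\<lambda>s. b s * exp (\<alpha> * (A s - A (h s)))) h \<beta>' r t\<^sub>1 t\<^sub>2 t\<^sub>3"
proof
  have cont_A: "continuous_on {0..} A"
    by (rule lipschitz_on_continuous_on[OF lipschitz_A])
  show "continuous_on {0..} (\<lambda>s. (1 - \<alpha>) * A s)"
    by (intro continuous_intros cont_A)
  show "continuous_on {0..} (\<lambda>s. exp (\<alpha> * A s) * x s)"
    by (intro continuous_intros cont_A continuous_x)
  show "((\<lambda>s. (1 - \<alpha>) * a s) has_integral (1 - \<alpha>) * A v - (1 - \<alpha>) * A u) {u..v}"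
    if "0 \<le> u" "u \<le> v" for u v
    using has_integral_mult_right[OF has_integral_a[OF that], of "1 - \<alpha>"] by (simp add: right_diff_distrib)
  show "((\<lambda>s. (1 - \<alpha>) * a s * exp ((1 - \<alpha>) * A s)) has_integral
      exp ((1 - \<alpha>) * A v) - exp ((1 - \<alpha>) * A u)) {u..v}" if "0 \<le> u" "u \<le> v" for u v
    by (rule has_integral_a_exp[OF that])
  show "((\<lambda>s. - (b s * exp (\<alpha> * (A s - A (h s))) * (exp (\<alpha> * A (h s)) * x (h s))) * exp ((1 - \<alpha>) * A s))
      has_integral exp ((1 - \<alpha>) * A v) * (exp (\<alpha> * A v) * x v)
        - exp ((1 - \<alpha>) * A u) * (exp (\<alpha> * A u) * x u)) {u..v}" if "t\<^sub>1 \<le> u" "u \<le> v" for u v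
  proof -
    \<comment> \<open>The integrating factor and the weight multiply to \<open>exp (A s)\<close>, so
      the integrated equation is that of \<open>x\<close> itself.\<close>
    have E: "exp ((1 - \<alpha>) * A s) * exp (\<alpha> * A s) = exp (A s)" for s
      by (simp add: algebra_simps flip: exp_add)
    have F: "exp (\<alpha> * (A s - A (h s))) * exp (\<alpha> * A (h s)) = exp (\<alpha> * A s)" for s
      by (simp add: algebra_simps flip: exp_add)
    have G: "- (b s * exp (\<alpha> * (A s - A (h s))) * (exp (\<alpha> * A (h s)) * x (h s))) * exp ((1 - \<alpha>) * A s)
        = - (b s * x (h s)) * exp (A s)" for s
      unfolding E[of s, symmetric] F[of s, symmetric] by (simp add: mult_ac)
    have "((\<lambda>s. - (b s * x (h s)) * exp (A s)) has_integral exp (A v) * x v - exp (A u) * x u) {u..v}"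
      using that times by (intro has_integral_exp_A_x) auto
    moreover have "exp ((1 - \<alpha>) * A w) * (exp (\<alpha> * A w) * x w) = exp (A w) * x w" for w
      by (simp add: E flip: mult.assoc)
    ultimately show ?thesis by (simp only: G)
  qed
  fix s assume s: "t\<^sub>1 \<le> s"
  then have "0 \<le> s" using times by simp
  show "0 \<le> b s * exp (\<alpha> * (A s - A (h s)))" using nonneg(2)[OF \<open>0 \<le> s\<close>] by simp
  have "exp (\<alpha> * (A s - A (h s))) \<le> exp (\<alpha> * r)" using t\<^sub>1(3)[OF s] \<alpha> by simp
  then have "b s * exp (\<alpha> * (A s - A (h s))) \<le> \<beta>\<^sub>1 * a s * exp (\<alpha> * r)"
    using t\<^sub>1(1)[OF s] nonneg[OF \<open>0 \<le> s\<close>] \<open>0 \<le> \<beta>\<^sub>1\<close> by (intro mult_mono) auto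
  also have "\<dots> = \<beta>\<^sub>1 * exp (\<alpha> * r) * a s" by simp
  also have "\<dots> \<le> \<beta>' * (1 - \<alpha>) * a s" using \<alpha>(3) nonneg(1)[OF \<open>0 \<le> s\<close>] by (rule mult_right_mono)
  finally show "b s * exp (\<alpha> * (A s - A (h s))) \<le> \<beta>' * ((1 - \<alpha>) * a s)" by (simp add: mult.assoc)
  \<comment> \<open>\<open>A\<close> is nondecreasing, so the slower clock
    \<open>(1 - \<alpha>) * A\<close> does not lengthen the delay.\<close>
  have "0 \<le> A s - A (h s)"
    by (rule has_integral_nonneg[OF has_integral_a]) (use t\<^sub>1(2)[OF s] h_le[OF \<open>0 \<le> s\<close>] nonneg(1) in auto)
  then have "(1 - \<alpha>) * (A s - A (h s)) \<le> 1 * (A s - A (h s))" using \<alpha> by (intro mult_right_mono) auto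
  with t\<^sub>1(3)[OF s] show "(1 - \<alpha>) * A s - (1 - \<alpha>) * A (h s) \<le> r" by (simp add: right_diff_distrib)
  show "h s \<le> s" by (rule h_le[OF \<open>0 \<le> s\<close>])
qed (use assms in auto)

section \<open>Choice of the constants and the decay estimate\<close>

theorem theorem2:
  fixes a b h :: "real \<Rightarrow> real" and a0 h0 \<beta> :: real
  assumes "a \<in> borel_measurable (lebesgue_on {0..})"
    and "b \<in> borel_measurable (lebesgue_on {0..})"
    and "h \<in> borel_measurable (lebesgue_on {0..})"
    and "essentially_bounded a"
    and "essentially_bounded b"
    and "\<And>t. t \<ge> 0 \<Longrightarrow> a t \<ge> 0"
    and "\<And>t. t \<ge> 0 \<Longrightarrow> b t \<ge> 0"
    and "\<And>t. t \<ge> 0 \<Longrightarrow> h t \<le> t"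
    and "filterlim h at_top at_top"
    and "a0 > 0"
    and "\<And>t. t \<ge> 0 \<Longrightarrow> a t \<ge> a0"
    and "Limsup at_top (\<lambda>t. ereal (LINT s:{h t..t}|lebesgue. a s)) = ereal h0"
    and "Limsup at_top (\<lambda>t. ereal (b t / a t)) = ereal \<beta>"
    \<comment> \<open>for \<open>\<beta> = 0\<close> the inequality reads \<open>\<infinity> > -\<infinity>\<close>, whereas in HOL \<open>1 / 0 = 0\<close> and \<open>ln 0 = 0\<close>\<close>
    and "\<beta> = 0 \<or> (1 / \<beta>) * exp (- h0) > ln ((\<beta>\<^sup>2 + \<beta>) / (\<beta>\<^sup>2 + 1))"
  shows "exponentially_stable a b h"
proof -
  obtain C\<^sub>a where "AE t in lebesgue_on {0..}. \<bar>a t\<bar> \<le> C\<^sub>a"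
    using assms(4) by (auto simp: essentially_bounded_def)
  then obtain N\<^sub>a where N\<^sub>a: "negligible N\<^sub>a" "\<And>t. 0 \<le> t \<Longrightarrow> t \<notin> N\<^sub>a \<Longrightarrow> \<bar>a t\<bar> \<le> C\<^sub>a"
    by (rule AE_lebesgue_on_negligible) (rule that)
  obtain C\<^sub>b where "AE t in lebesgue_on {0..}. \<bar>b t\<bar> \<le> C\<^sub>b"
    using assms(5) by (auto simp: essentially_bounded_def)
  then obtain N\<^sub>b where N\<^sub>b: "negligible N\<^sub>b" "\<And>t. 0 \<le> t \<Longrightarrow> t \<notin> N\<^sub>b \<Longrightarrow> \<bar>b t\<bar> \<le> C\<^sub>b"
    by (rule AE_lebesgue_on_negligible) (rule that)
  interpret bounded_coefficients a b h "max 0 C\<^sub>a" "max 0 C\<^sub>b" "N\<^sub>a \<union> N\<^sub>b"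
    by unfold_locales (use assms(1,8) N\<^sub>a N\<^sub>b in \<open>auto simp: le_max_iff_disj\<close>)
  obtain \<beta>' r where \<beta>': "0 < \<beta>'" "\<beta> < \<beta>'" "h0 < r" "ln (1 + 1 / \<beta>') \<le> r" "contraction_factor \<beta>' r < 1"
    using perturbed_delay_parameters[OF assms(14)] by blast
  \<comment> \<open>Above \<open>\<beta>\<close>, this value bounds \<open>b / a\<close> eventually;
    below \<open>\<beta>'\<close>, it leaves room for \<open>\<alpha>\<close>. The
    \<open>max\<close> makes it nonnegative.\<close>
  define \<beta>\<^sub>1 where "\<beta>\<^sub>1 = (max \<beta> 0 + \<beta>') / 2"
  have \<beta>\<^sub>1: "0 \<le> \<beta>\<^sub>1" "\<beta> < \<beta>\<^sub>1" "\<beta>\<^sub>1 < \<beta>'" using \<beta>' by (auto simp: \<beta>\<^sub>1_def)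
  obtain \<alpha> where \<alpha>: "0 < \<alpha>" "\<alpha> < 1" "\<beta>\<^sub>1 * exp (\<alpha> * r) \<le> \<beta>' * (1 - \<alpha>)"
    using small_exponent[OF \<beta>\<^sub>1(3)] by blast
  have "\<forall>\<^sub>F t in at_top. ereal (LINT s:{h t..t}|lebesgue. a s) < ereal r"
    by (rule Limsup_lessD) (use assms(12) \<beta>'(3) in simp)
  moreover have "\<forall>\<^sub>F t in at_top. ereal (b t / a t) < ereal \<beta>\<^sub>1"
    by (rule Limsup_lessD) (use assms(13) \<beta>\<^sub>1(2) in simp)
  moreover have h_top: "\<forall>\<^sub>F t in at_top. C \<le> h t" for C
    using assms(9) by (simp add: filterlim_at_top)
  ultimately have "\<forall>\<^sub>F t in at_top. ereal (LINT s:{h t..t}|lebesgue. a s) < ereal r \<and>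
      ereal (b t / a t) < ereal \<beta>\<^sub>1 \<and> 0 \<le> h t"
    by (intro eventually_conj)
  then obtain t\<^sub>0 where t\<^sub>0: "\<And>t. t\<^sub>0 \<le> t \<Longrightarrow> (LINT s:{h t..t}|lebesgue. a s) < r \<and>
      b t / a t < \<beta>\<^sub>1 \<and> 0 \<le> h t"
    unfolding eventually_at_top_linorder by auto
  define t\<^sub>1 where "t\<^sub>1 = max t\<^sub>0 0"
  have t\<^sub>1: "b s \<le> \<beta>\<^sub>1 * a s" "0 \<le> h s" "A s - A (h s) \<le> r" if "t\<^sub>1 \<le> s" for s
  proof -
    have s: "t\<^sub>0 \<le> s" "0 \<le> s" using that by (auto simp: t\<^sub>1_def)
    then have "0 < a s" using assms(10) assms(11)[of s] by linarith
    with t\<^sub>0[OF s(1)] show "b s \<le> \<beta>\<^sub>1 * a s" by (simp add: field_simps)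
    show "0 \<le> h s" using t\<^sub>0[OF s(1)] by simp
    with assms(8)[OF s(2)] have "A s - A (h s) = integral {h s..s} a" by (simp add: integral_a)
    also have "\<dots> = (LINT s:{h s..s}|lebesgue. a s)"
      by (rule set_lebesgue_integral_eq_integral(2)[OF absolutely_integrable_a[OF \<open>0 \<le> h s\<close>], symmetric])
    finally show "A s - A (h s) \<le> r" using t\<^sub>0[OF s(1)] by simp
  qed
  \<comment> \<open>Using twice that \<open>h\<close> tends to infinity leaves room for two delays
    after \<open>t\<^sub>1\<close>.\<close>
  obtain t\<^sub>2 where t\<^sub>2: "t\<^sub>1 \<le> t\<^sub>2" "\<And>s. t\<^sub>2 \<le> s \<Longrightarrow> t\<^sub>1 \<le> h s"
    using h_top[of t\<^sub>1] unfolding eventually_at_top_linorder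
    by (metis max.bounded_iff max.cobounded1)
  obtain t\<^sub>3 where t\<^sub>3: "t\<^sub>2 \<le> t\<^sub>3" "\<And>s. t\<^sub>3 \<le> s \<Longrightarrow> t\<^sub>2 \<le> h s"
    using h_top[of t\<^sub>2] unfolding eventually_at_top_linorder
    by (metis max.bounded_iff max.cobounded1)
  have "0 \<le> t\<^sub>1" by (simp add: t\<^sub>1_def)
  have A_mono: "A u \<le> A v" if "0 \<le> u" "u \<le> v" for u v
    using has_integral_nonneg[OF has_integral_a[OF that]] assms(6) that by simp
  \<comment> \<open>This converts decay on the clock \<open>A\<close> into decay in time, at rate
    \<open>\<alpha> * a0\<close>.\<close>
  have A_ge: "a0 * t \<le> A t" if "0 \<le> t" for t
  proof -
    have "((\<lambda>s. a0) has_integral a0 * t) {0..t}"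
      using has_integral_const_real[of a0 0 t] that by (simp add: mult.commute)
    moreover have "(a has_integral A t) {0..t}"
      using has_integral_a[of 0 t] that by (simp add: A_def)
    ultimately show ?thesis by (rule has_integral_le) (use assms(11) in auto)
  qed
  \<comment> \<open>Enough doubling steps of \<open>growth_le\<close> to reach
    \<open>t\<^sub>3\<close>; thus \<open>M\<close> below does not depend on
    \<open>\<phi>\<close>.\<close>
  define n where "n = nat \<lceil>t\<^sub>3 * (2 * (max 0 C\<^sub>a + max 0 C\<^sub>b + 1))\<rceil>"
  have n: "t\<^sub>3 \<le> real n / (2 * (max 0 C\<^sub>a + max 0 C\<^sub>b + 1))"
    unfolding n_def by (simp add: pos_le_divide_eq add_nonneg_pos real_nat_ceiling_ge)
  define M where "M = exp (\<alpha> * A t\<^sub>3) * 2 ^ n"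
  show ?thesis
    unfolding exponentially_stable_def
  proof (intro exI conjI allI impI)
    show "0 < M" by (simp add: M_def)
    show "0 < \<alpha> * a0" using \<alpha> assms(10) by simp
    fix \<phi> x t assume "initial_function \<phi>" "delay_solution a b h \<phi> x" and t: "0 \<le> (t::real)"
    then interpret bounded_coefficients_solution a b h "max 0 C\<^sub>a" "max 0 C\<^sub>b" "N\<^sub>a \<union> N\<^sub>b" \<phi> x
      by unfold_locales
    interpret W: weighted_delay_equation "\<lambda>s. exp (\<alpha> * A s) * x s" "\<lambda>s. (1 - \<alpha>) * A s"
      "\<lambda>s. (1 - \<alpha>) * a s" "\<lambda>s. b s * exp (\<alpha> * (A s - A (h s)))" h \<beta>' r t\<^sub>1 t\<^sub>2 t\<^sub>3
      using \<alpha> \<beta>\<^sub>1 \<beta>' assms(6,7) t\<^sub>1 t\<^sub>2 t\<^sub>3 \<open>0 \<le> t\<^sub>1\<close> by (intro weighted_solution)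
    have "\<bar>exp (\<alpha> * A t) * x t\<bar> \<le> M * initial_norm \<phi>"
    proof (rule W.bounded_by_history[OF \<beta>'(5) _ t])
      fix s assume s: "s \<in> {0..t\<^sub>3}"
      then have "\<bar>x s\<bar> \<le> 2 ^ n * initial_norm \<phi>" using n by (intro growth_le) auto
      moreover have "exp (\<alpha> * A s) \<le> exp (\<alpha> * A t\<^sub>3)" using A_mono[of s t\<^sub>3] s \<alpha> by simp
      ultimately show "\<bar>exp (\<alpha> * A s) * x s\<bar> \<le> M * initial_norm \<phi>"
        unfolding M_def abs_mult mult.assoc by (intro mult_mono) auto
    qed
    then have "exp (- (\<alpha> * A t)) * (exp (\<alpha> * A t) * \<bar>x t\<bar>) \<le> exp (- (\<alpha> * A t)) * (M * initial_norm \<phi>)"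
      by (intro mult_left_mono) (auto simp: abs_mult)
    then have "\<bar>x t\<bar> \<le> exp (- (\<alpha> * A t)) * (M * initial_norm \<phi>)"
      by (simp flip: mult.assoc exp_add)
    also have "\<dots> \<le> exp (- (\<alpha> * a0) * t) * (M * initial_norm \<phi>)"
    proof (rule mult_right_mono)
      show "exp (- (\<alpha> * A t)) \<le> exp (- (\<alpha> * a0) * t)"
        using mult_left_mono[OF A_ge[OF t], of \<alpha>] \<alpha> by (simp add: mult.assoc)
      show "0 \<le> M * initial_norm \<phi>" using \<open>0 < M\<close> initial_norm_nonneg by simp
    qed
    finally show "\<bar>x t\<bar> \<le> M * initial_norm \<phi> * exp (- (\<alpha> * a0) * t)" by (simp add: mult_ac)
  qed
qed

end
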